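(* Each thin Blaschke product is gluable.
   Context: $\mathbb{D}$ is the open unit disk. A thin Blaschke product is an infinite Blaschke product $B$ whose zero sequence $\{z_n\}$ satisfies $\lim_{k\to\infty}\prod_{j\ne k} d(z_j,z_k)=1$, where $d(z,\lambda)=\left|\frac{\lambda-z}{1-\overline{\lambda}z}\right|$. Let $\psi$ be a holomorphic function on $\mathbb{D}$ such that $H=\psi^{-1}(\psi(Z(\psi')))$ is relatively closed in $\mathbb{D}$ and $E=\mathbb{D}\setminus H$ is connected, where $Z(\psi')=\{z\in\mathbb{D}:\psi'(z)=0\}$ (for a thin Blaschke product $H$ has no accumulation point in $\mathbb{D}$). Two points $z_1\neq z_2$ in $E$ with $\psi(z_1)=\psi(z_2)$ are called directly $\psi$-glued if there are two paths (continuous maps) $\sigma_1,\sigma_2:[0,1]\to\mathbb{D}$ with: (i) $\sigma_i(0)=z_i$ for $i=1,2$ and $\sigma_1(1)=\sigma_2(1)$; (ii) $\psi(\sigma_1(t))=\psi(\sigma_2(t))$ for $0\le t\le1$; (iii) $\sigma_i(t)\in E$ for $0\le t<1$, $i=1,2$. By convention every point of $E$ is directly $\psi$-glued to itself. Two points $z_0,z_k$ are $\psi$-glued on $\mathbb{D}$ if there is a finite sequence $z_0,z_1,\dots,z_k$ such that $z_j$ and $z_{j+1}$ are directly $\psi$-glued for $0\le j\le k-1$. The function $\psi$ is gluable with respect to $w\in E$ if $w$ is $\psi$-glued on $\mathbb{D}$ to every $z\in\psi^{-1}(\psi(w))$, and $\psi$ is gluable if it is gluable with respect to every $w\in E$.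 *)

theory Defs
  imports "HOL-Complex_Analysis.Complex_Analysis"
begin

abbreviation unit_disk :: "complex set" (\<open>\<D>\<close>)
  where "\<D> \<equiv> ball 0 1"

definition pseudohyp_dist :: "complex \<Rightarrow> complex \<Rightarrow> real"
  where "pseudohyp_dist z l = cmod ((l - z) / (1 - cnj l * z))"

definition blaschke_factor :: "complex \<Rightarrow> complex \<Rightarrow> complex"
  where "blaschke_factor a w =
    (if a = 0 then w else of_real (cmod a) / a * ((a - w) / (1 - cnj a * w)))"

text \<open>The zeros are listed with multiplicity. Values of \<open>B\<close> outside the disk are unconstrained.\<close>

definition blaschke_product_with_zeros :: "(complex \<Rightarrow> complex) \<Rightarrow> (nat \<Rightarrow> complex) \<Rightarrow> bool"
  where "blaschke_product_with_zeros B z \<longleftrightarrow>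
    (\<forall>n. z n \<in> \<D>) \<and> summable (\<lambda>n. 1 - cmod (z n)) \<and>
    (\<exists>c. cmod c = 1 \<and> (\<forall>w\<in>\<D>. B w = c * (\<Prod>n. blaschke_factor (z n) w)))"

text \<open>The factor with index \<open>j = k\<close> is omitted by replacing it with 1. The infinite products here
  and above converge by the summability condition on the zeros.\<close>

definition thin_blaschke_product :: "(complex \<Rightarrow> complex) \<Rightarrow> bool"
  where "thin_blaschke_product B \<longleftrightarrow>
    (\<exists>z. blaschke_product_with_zeros B z \<and>
      (\<lambda>k. \<Prod>j. if j = k then 1 else pseudohyp_dist (z j) (z k)) \<longlonglongrightarrow> 1)"

definition critical_fibres :: "(complex \<Rightarrow> complex) \<Rightarrow> complex set"
  where "critical_fibres \<psi> = {z \<in> \<D>. \<psi> z \<in> \<psi> ` {u \<in> \<D>. deriv \<psi> u = 0}}"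

definition regular_part :: "(complex \<Rightarrow> complex) \<Rightarrow> complex set"
  where "regular_part \<psi> = \<D> - critical_fibres \<psi>"

definition directly_glued :: "(complex \<Rightarrow> complex) \<Rightarrow> complex \<Rightarrow> complex \<Rightarrow> bool"
  where "directly_glued \<psi> z1 z2 \<longleftrightarrow>
    z1 \<in> regular_part \<psi> \<and> z2 \<in> regular_part \<psi> \<and>
    (z1 = z2 \<or>
     \<psi> z1 = \<psi> z2 \<and>
     (\<exists>\<sigma>1 \<sigma>2. path \<sigma>1 \<and> path \<sigma>2 \<and> path_image \<sigma>1 \<subseteq> \<D> \<and> path_image \<sigma>2 \<subseteq> \<D> \<and>
        pathstart \<sigma>1 = z1 \<and> pathstart \<sigma>2 = z2 \<and> pathfinish \<sigma>1 = pathfinish \<sigma>2 \<and>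
        (\<forall>t\<in>{0..1}. \<psi> (\<sigma>1 t) = \<psi> (\<sigma>2 t)) \<and>
        (\<forall>t\<in>{0..<1}. \<sigma>1 t \<in> regular_part \<psi> \<and> \<sigma>2 t \<in> regular_part \<psi>)))"

text \<open>Finite chains of directly glued points; since direct gluing is reflexive on the regular part,
  the transitive closure is already reflexive there.\<close>

definition glued :: "(complex \<Rightarrow> complex) \<Rightarrow> complex \<Rightarrow> complex \<Rightarrow> bool"
  where "glued \<psi> = (directly_glued \<psi>)\<^sup>+\<^sup>+"

definition gluable_wrt :: "(complex \<Rightarrow> complex) \<Rightarrow> complex \<Rightarrow> bool"
  where "gluable_wrt \<psi> w \<longleftrightarrow> (\<forall>z\<in>\<D>. \<psi> z = \<psi> w \<longrightarrow> glued \<psi> w z)"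

text \<open>The first three conjuncts are the standing assumptions under which gluability is defined;
  they are part of what is claimed when a function is called gluable.\<close>

definition gluable :: "(complex \<Rightarrow> complex) \<Rightarrow> bool"
  where "gluable \<psi> \<longleftrightarrow>
    \<psi> holomorphic_on \<D> \<and>
    closedin (top_of_set \<D>) (critical_fibres \<psi>) \<and>
    connected (regular_part \<psi>) \<and>
    (\<forall>w\<in>regular_part \<psi>. gluable_wrt \<psi> w)"

end

theory Submission
  imports Defs
begin

text \<open>Let \<open>B\<close> be a thin Blaschke product. Two facts combine: over the disk \<open>B\<close> behaves like a
  branched covering, even though it has infinitely many sheets, and for such maps simple connectivity
  of the disk forces every fibre to be glued together.

  The branched covering. Let \<open>z\<^sub>k\<close> be the zeros and \<open>\<delta>\<^sub>k\<close> the pseudohyperbolic products, so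
  \<open>\<delta>\<^sub>k \<rightarrow> 1\<close>. In the coordinate \<open>\<zeta>\<close> of the disk centred at \<open>z\<^sub>k\<close>, the product is \<open>\<zeta> h(\<zeta>)\<close>
  with \<open>|h| \<le> 1\<close> and \<open>|h(0)| = \<delta>\<^sub>k\<close>. By Schwarz--Pick, \<open>h\<close> is nearly constant on \<open>|\<zeta>| < R\<close>, so for
  large \<open>k\<close> the product is injective there and larger than \<open>r < R\<close> on the boundary circle; hence a
  neighbourhood of \<open>z\<^sub>k\<close> is mapped bijectively onto the disk of radius \<open>r\<close> (\<open>sheet_near_zero\<close>).
  Away from these neighbourhoods, the minimum modulus principle for finite subproducts keeps \<open>|B|\<close>
  above \<open>r\<close> near the unit circle. So \<open>{|B| < r}\<close> consists of such sheets and a part with compact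
  closure (\<open>sublevel_sets_of_thin\<close>). The compact part meets a fibre in finitely many points, and
  so every value has a disk around it whose preimage splits into relatively compact pieces, each
  containing one point of the fibre (\<open>branched_covering_of_sheets\<close>).

  Gluing. Over the regular values \<open>B\<close> is a covering map. Fix a base value and move slightly to a
  point \<open>p\<close> such that every ray from \<open>p\<close> meets at most one critical value. Removing from the disk, for
  each critical value \<open>v\<close>, the part of the ray through \<open>v\<close> lying at or beyond \<open>v\<close> leaves a domain that
  is star-shaped about \<open>p\<close>. The covering is trivial over it, so each point over it lies on a unique
  sheet, which is labelled by a point of the base fibre. Two sheets that come together at a point
  over the critical value \<open>v\<close> have directly glued labels: lift to both the path that ends with the
  segment from \<open>p\<close> to \<open>v\<close> (\<open>glued_over_critical_value\<close>). Two sheets that are adjacent across a slit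
  remain adjacent when one follows the slit back to its tip, so their labels are glued as well
  (\<open>locally_glued_on_slit\<close>). Hence the gluing class of the label is locally constant on the
  unit disk, which is connected (\<open>fibre_glued\<close>).\<close>

section \<open>Charts of a branched covering of the disk\<close>

text \<open>A piece of the preimage of a small disk, with centre \<open>c\<close> over the centre \<open>q\<close>. Properness is
  encoded by relative compactness together with relative closedness in the preimage; surjectivity and
  injectivity are demanded at regular centres only, since at a branch point it is enough to know that
  \<open>c\<close> is the only point over \<open>q\<close>.\<close>

definition branched_chart ::
    "(complex \<Rightarrow> complex) \<Rightarrow> complex \<Rightarrow> real \<Rightarrow> complex set \<Rightarrow> complex \<Rightarrow> bool"
  where "branched_chart f q e N c \<longleftrightarrow>
    open N \<and> c \<in> N \<and> f c = q \<and> closure N \<subseteq> \<D> \<and> f ` N \<subseteq> ball q e \<and>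
    (\<forall>x\<in>closure N. f x \<in> ball q e \<longrightarrow> x \<in> N) \<and>
    (\<forall>x\<in>N. f x = q \<or> deriv f x = 0 \<longrightarrow> x = c) \<and>
    (deriv f c \<noteq> 0 \<longrightarrow> inj_on f N \<and> f ` N = ball q e)"

lemma branched_chartD:
  assumes "branched_chart f q e N c"
  shows chart_open: "open N"
    and chart_centre: "c \<in> N" "f c = q"
    and chart_closure: "closure N \<subseteq> \<D>"
    and chart_subset: "N \<subseteq> \<D>"
    and chart_image: "\<And>x. x \<in> N \<Longrightarrow> f x \<in> ball q e"
    and chart_closed: "\<And>x. x \<in> closure N \<Longrightarrow> f x \<in> ball q e \<Longrightarrow> x \<in> N"
    and chart_fibre: "\<And>x. x \<in> N \<Longrightarrow> f x = q \<Longrightarrow> x = c"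
    and chart_critical: "\<And>x. x \<in> N \<Longrightarrow> deriv f x = 0 \<Longrightarrow> x = c"
    and chart_inj: "deriv f c \<noteq> 0 \<Longrightarrow> inj_on f N"
    and chart_onto: "deriv f c \<noteq> 0 \<Longrightarrow> f ` N = ball q e"
proof -
  note D = assms[unfolded branched_chart_def]
  show "open N" using D by (elim conjE)
  show "c \<in> N" using D by (elim conjE)
  show "f c = q" using D by (elim conjE)
  show "closure N \<subseteq> \<D>" using D by (elim conjE)
  then show "N \<subseteq> \<D>" by (rule order_trans[OF closure_subset])
  have im: "f ` N \<subseteq> ball q e" using D by (elim conjE)
  show "f x \<in> ball q e" if "x \<in> N" for x
    using im that by (rule subsetD[OF _ imageI])
  have cl: "\<forall>x\<in>closure N. f x \<in> ball q e \<longrightarrow> x \<in> N" using D by (elim conjE)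
  show "x \<in> N" if "x \<in> closure N" "f x \<in> ball q e" for x
    using bspec[OF cl that(1)] that(2) by (rule mp)
  have un: "\<forall>x\<in>N. f x = q \<or> deriv f x = 0 \<longrightarrow> x = c" using D by (elim conjE)
  show "x = c" if "x \<in> N" "f x = q" for x
    using bspec[OF un that(1)] disjI1[OF that(2)] by (rule mp)
  show "x = c" if "x \<in> N" "deriv f x = 0" for x
    using bspec[OF un that(1)] disjI2[OF that(2)] by (rule mp)
  have reg: "deriv f c \<noteq> 0 \<longrightarrow> inj_on f N \<and> f ` N = ball q e" using D by (elim conjE)
  show "inj_on f N" if "deriv f c \<noteq> 0"
    using mp[OF reg that] by (rule conjunct1)
  show "f ` N = ball q e" if "deriv f c \<noteq> 0"
    using mp[OF reg that] by (rule conjunct2)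
qed

lemma fsigma_disk: "fsigma \<D>"
proof -
  have "\<D> = (\<Union>n. cball 0 (1 - inverse (real (Suc n))))"
  proof (intro set_eqI iffI)
    fix x :: complex assume "x \<in> \<D>"
    then obtain n where "inverse (real (Suc n)) < 1 - cmod x"
      using reals_Archimedean[of "1 - cmod x"] by auto
    then show "x \<in> (\<Union>n. cball 0 (1 - inverse (real (Suc n))))"
      by (intro UN_I[of n]) auto
  next
    fix x :: complex assume "x \<in> (\<Union>n. cball 0 (1 - inverse (real (Suc n))))"
    then obtain n where "cmod x \<le> 1 - inverse (real (Suc n))" by auto
    moreover have "inverse (real (Suc n)) > 0" by simp
    ultimately have "cmod x < 1" by linarith
    then show "x \<in> \<D>" by simp
  qed
  then show ?thesis by (simp add: fsigma.intros)
qed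

text \<open>Charts are required for all sufficiently small radii, so that the radius can later be adapted to
  other conditions on the disk around \<open>q\<close>.\<close>

locale branched_disk_covering =
  fixes f :: "complex \<Rightarrow> complex"
  assumes hol: "f holomorphic_on \<D>"
    and surj: "f ` \<D> = \<D>"
    and charts: "q \<in> \<D> \<Longrightarrow> \<exists>d>0. \<forall>e. 0 < e \<and> e \<le> d \<longrightarrow>
      (\<forall>z\<in>\<D>. f z \<in> ball q e \<longrightarrow> (\<exists>N c. branched_chart f q e N c \<and> z \<in> N))"
begin

definition critical_values :: "complex set"
  where "critical_values = f ` {u \<in> \<D>. deriv f u = 0}"

definition regular_values :: "complex set"
  where "regular_values = \<D> - critical_values"

lemma in_disk: "z \<in> \<D> \<Longrightarrow> f z \<in> \<D>"
  using surj by blast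

lemma regular_part_eq: "regular_part f = {z \<in> \<D>. f z \<in> regular_values}"
  using in_disk unfolding regular_part_def critical_fibres_def regular_values_def critical_values_def
  by auto

lemma cont: "continuous_on \<D> f"
  using hol by (rule holomorphic_on_imp_continuous_on)

lemma nonconstant: "\<not> f constant_on \<D>"
proof
  assume "f constant_on \<D>"
  then obtain k where k: "\<And>z. z \<in> \<D> \<Longrightarrow> f z = k"
    by (auto simp: constant_on_def)
  have "\<D> \<subseteq> {k}" using surj k by blast
  moreover have "0 \<in> \<D>" "1/2 \<in> \<D>" by auto
  ultimately have "(0::complex) = 1/2" by blast
  then show False by simp
qed

lemma open_image: "open U \<Longrightarrow> U \<subseteq> \<D> \<Longrightarrow> open (f ` U)"
  by (rule open_mapping_thm[OF hol open_ball connected_ball _ _ nonconstant])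

lemma open_preimage: "open W \<Longrightarrow> open {z \<in> \<D>. f z \<in> W}"
  using continuous_open_preimage[OF cont open_ball] by (simp add: vimage_def Int_def)

text \<open>A chart is open and closed in the preimage of its disk, so a connected part of that preimage
  cannot leave it.\<close>

lemma chart_traps_connected:
  assumes N: "branched_chart f q e N c" and "connected X" and X: "X \<subseteq> \<D>" "f ` X \<subseteq> ball q e"
    and ne: "X \<inter> N \<noteq> {}"
  shows "X \<subseteq> N"
proof -
  have "X \<inter> N = X \<inter> closure N"
  proof
    show "X \<inter> N \<subseteq> X \<inter> closure N" using closure_subset[of N] by blast
    have "x \<in> N" if "x \<in> X" "x \<in> closure N" for x
      using chart_closed[OF N that(2)] X(2) that(1) by blast
    then show "X \<inter> closure N \<subseteq> X \<inter> N" by blast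
  qed
  moreover have "openin (top_of_set X) (X \<inter> N)"
    using chart_open[OF N] by (rule openin_open_Int)
  moreover have "closedin (top_of_set X) (X \<inter> closure N)"
    by (auto simp: closedin_closed_Int)
  ultimately show ?thesis
    using \<open>connected X\<close> ne by (auto simp: connected_clopen)
qed

text \<open>Since the chart is relatively compact, a family in it whose values tend to \<open>q\<close> can accumulate
  only at points over \<open>q\<close>, and \<open>c\<close> is the only one. This is what makes lifted paths converge at branch
  points.\<close>

lemma chart_tendsto_centre:
  assumes N: "branched_chart f q e N c" and h: "eventually (\<lambda>t. h t \<in> N) F"
    and lim: "((\<lambda>t. f (h t)) \<longlongrightarrow> q) F" and "0 < e"
  shows "(h \<longlongrightarrow> c) F"
proof (rule topological_tendstoI)
  fix U assume U: "open U" "c \<in> U"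
  have "compact (closure N)"
    using bounded_subset[OF bounded_ball chart_closure[OF N]]
    by (simp add: compact_eq_bounded_closed)
  then have "compact (f ` (closure N - U))"
  proof (intro compact_continuous_image compact_diff)
    show "continuous_on (closure N - U) f"
      using chart_closure[OF N] by (intro continuous_on_subset[OF cont]) blast
  qed (use U in auto)
  then have op: "open (- f ` (closure N - U))"
    by (simp add: compact_imp_closed open_Compl)
  have "q \<notin> f ` (closure N - U)"
  proof
    assume "q \<in> f ` (closure N - U)"
    then obtain x where x: "x \<in> closure N" "x \<notin> U" "f x = q" by blast
    then have "x \<in> N" using chart_closed[OF N, of x] \<open>0 < e\<close> by simp
    then have "x = c" using chart_fibre[OF N] x by blast
    then show False using x U by blast
  qed
  then have "eventually (\<lambda>t. f (h t) \<in> - f ` (closure N - U)) F"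
    using lim op by (intro topological_tendstoD) auto
  with h show "eventually (\<lambda>t. h t \<in> U) F"
    by eventually_elim (use closure_subset in blast)
qed

lemma isolated_critical_value:
  assumes "q \<in> \<D>"
  shows "\<exists>d>0. ball q d \<inter> critical_values \<subseteq> {q}"
proof -
  obtain d where d: "d > 0" "\<And>z. z \<in> \<D> \<Longrightarrow> f z \<in> ball q d \<Longrightarrow> \<exists>N c. branched_chart f q d N c \<and> z \<in> N"
    using charts[OF assms] by (meson order_refl)
  have "ball q d \<inter> critical_values \<subseteq> {q}"
  proof
    fix v assume v: "v \<in> ball q d \<inter> critical_values"
    then obtain u where u: "u \<in> \<D>" "deriv f u = 0" "f u = v"
      by (auto simp: critical_values_def)
    then obtain N c where N: "branched_chart f q d N c" "u \<in> N"
      using d(2)[of u] v by auto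
    then have "u = c" using chart_critical u by blast
    then show "v \<in> {q}" using chart_centre(2)[OF N(1)] u by simp
  qed
  with d(1) show ?thesis by blast
qed

lemma open_regular_insert:
  assumes "v \<in> \<D>"
  shows "open (insert v regular_values)"
  unfolding open_contains_ball
proof
  fix q assume q: "q \<in> insert v regular_values"
  then have qD: "q \<in> \<D>" using assms by (auto simp: regular_values_def)
  obtain d where d: "d > 0" "ball q d \<inter> critical_values \<subseteq> {q}"
    using isolated_critical_value[OF qD] by blast
  obtain d' where d': "d' > 0" "ball q d' \<subseteq> \<D>"
    using qD by (metis open_ball openE)
  have "ball q (min d d') \<subseteq> insert v regular_values"
  proof
    fix x assume x: "x \<in> ball q (min d d')"
    then have "x \<in> \<D>" "x \<in> critical_values \<Longrightarrow> x = q"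
      using d d' by auto
    then show "x \<in> insert v regular_values"
      using q unfolding regular_values_def by blast
  qed
  then show "\<exists>e>0. ball q e \<subseteq> insert v regular_values"
    using d(1) d'(1) by (intro exI[of _ "min d d'"]) simp
qed

lemma open_regular_values: "open regular_values"
proof (cases "regular_values = {}")
  case False
  then obtain v where "v \<in> regular_values" by blast
  then show ?thesis
    using open_regular_insert[of v] by (simp add: insert_absorb regular_values_def)
qed simp

lemma open_regular_part: "open (regular_part f)"
  unfolding regular_part_eq by (rule open_preimage[OF open_regular_values])

lemma closedin_critical_fibres: "closedin (top_of_set \<D>) (critical_fibres f)"
proof -
  have eq: "critical_fibres f = \<D> \<inter> - regular_part f"
    unfolding regular_part_def critical_fibres_def by blast
  have "closed (- regular_part f)"
    using open_regular_part by (rule closed_Compl)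
  then show ?thesis
    unfolding eq by (rule closedin_closed_Int)
qed

lemma countable_fibre: "countable {z \<in> \<D>. f z = v}"
proof -
  have "countable {z \<in> \<D>. f z - v = 0}"
  proof (rule holomorphic_countable_zeros)
    show "(\<lambda>z. f z - v) holomorphic_on \<D>"
      by (intro holomorphic_on_diff hol holomorphic_on_const)
    show "\<not> (\<lambda>z. f z - v) constant_on \<D>"
    proof
      assume "(\<lambda>z. f z - v) constant_on \<D>"
      then obtain k where "\<forall>z\<in>\<D>. f z - v = k" by (auto simp: constant_on_def)
      then have "\<forall>z\<in>\<D>. f z = k + v" by (simp add: diff_eq_eq)
      then show False using nonconstant unfolding constant_on_def by blast
    qed
  qed (simp_all add: fsigma_disk)
  then show ?thesis by simp
qed

lemma countable_critical_points: "countable {z \<in> \<D>. deriv f z = 0}"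
proof (cases "deriv f constant_on \<D>")
  case True
  then obtain k where k: "\<And>z. z \<in> \<D> \<Longrightarrow> deriv f z = k" by (auto simp: constant_on_def)
  show ?thesis
  proof (cases "k = 0")
    case True
    have "(f has_field_derivative 0) (at z within \<D>)" if "z \<in> \<D>" for z
      using k[OF that] True holomorphic_derivI[OF hol open_ball that] by metis
    then have "f constant_on \<D>"
      unfolding constant_on_def by (metis has_field_derivative_zero_constant convex_ball)
    then show ?thesis using nonconstant by blast
  next
    case False
    then have "{z \<in> \<D>. deriv f z = 0} = {}" using k by auto
    then show ?thesis by (metis countable_empty)
  qed
next
  case False
  then show ?thesis
    using hol by (intro holomorphic_countable_zeros holomorphic_deriv fsigma_disk) auto
qed

lemma countable_critical_values: "countable critical_values"
  unfolding critical_values_def using countable_critical_points by blast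

lemma connected_regular_part: "connected (regular_part f)"
proof -
  have "critical_fibres f = (\<Union>v\<in>critical_values. {z \<in> \<D>. f z = v})"
    unfolding critical_fibres_def critical_values_def by auto
  then have "countable (critical_fibres f)"
    using countable_critical_values countable_fibre by simp
  then show ?thesis
    unfolding regular_part_def by (intro connected_open_diff_countable) auto
qed

lemma chart_homeomorphism:
  assumes N: "branched_chart f q e N c" and "deriv f c \<noteq> 0"
  shows "\<exists>g. homeomorphism N (ball q e) f g"
proof -
  have hol': "f holomorphic_on N" and inj: "inj_on f N"
    using holomorphic_on_subset[OF hol chart_subset[OF N]] chart_inj[OF N assms(2)] .
  have opn: "openin (top_of_set (ball q e)) (f ` U)" if U: "openin (top_of_set N) U" for U
  proof -
    have "open U" "U \<subseteq> \<D>"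
      using openin_open_trans[OF U chart_open[OF N]] openin_imp_subset[OF U] chart_subset[OF N]
      by blast+
    then have "open (f ` U)" by (rule open_image)
    moreover have "f ` U \<subseteq> ball q e"
      using openin_imp_subset[OF U] chart_image[OF N] by blast
    ultimately show ?thesis by (simp add: open_openin_trans)
  qed
  show ?thesis
    using homeomorphism_injective_open_map[OF holomorphic_on_imp_continuous_on[OF hol']
        chart_onto[OF N assms(2)] inj opn] by metis
qed

lemma regular_chart_at:
  assumes N: "branched_chart f q e N c" and "q \<in> regular_values"
  shows "deriv f c \<noteq> 0"
proof
  assume "deriv f c = 0"
  moreover have "c \<in> \<D>" using chart_centre(1)[OF N] chart_subset[OF N] by blast
  ultimately have "f c \<in> critical_values" unfolding critical_values_def by blast
  then show False using assms(2) chart_centre(2)[OF N] unfolding regular_values_def by simp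
qed

text \<open>Over a disk of regular values every chart is mapped homeomorphically onto the disk. Charts that
  meet coincide, because each is connected and traps the other.\<close>

lemma covering: "covering_space (regular_part f) f regular_values"
proof
  show "continuous_on (regular_part f) f"
    by (rule continuous_on_subset[OF cont]) (auto simp: regular_part_def)
  show "f ` regular_part f = regular_values"
  proof
    show "f ` regular_part f \<subseteq> regular_values" unfolding regular_part_eq by blast
    show "regular_values \<subseteq> f ` regular_part f"
    proof
      fix q assume q: "q \<in> regular_values"
      then have "q \<in> f ` \<D>" unfolding surj regular_values_def by blast
      then show "q \<in> f ` regular_part f" using q unfolding regular_part_eq by blast
    qed
  qed
next
  fix q assume q: "q \<in> regular_values"
  then have qD: "q \<in> \<D>" by (simp add: regular_values_def)
  obtain d where d: "d > 0" "\<And>e z. 0 < e \<Longrightarrow> e \<le> d \<Longrightarrow> z \<in> \<D> \<Longrightarrow> f z \<in> ball q e \<Longrightarrow>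
      \<exists>N c. branched_chart f q e N c \<and> z \<in> N"
    using charts[OF qD] by blast
  obtain d' where d': "d' > 0" "ball q d' \<subseteq> regular_values"
    using q open_regular_values by (metis openE)
  define e where "e = min d d'"
  have e: "e > 0" "e \<le> d" "ball q e \<subseteq> regular_values"
    using d(1) d' unfolding e_def by auto
  define \<V> where "\<V> = {N. \<exists>c. branched_chart f q e N c}"
  have sub: "N \<subseteq> regular_part f" if "branched_chart f q e N c" for N c
    using chart_subset[OF that] chart_image[OF that] e(3) unfolding regular_part_eq by blast
  have U: "\<Union>\<V> = regular_part f \<inter> f -` ball q e"
  proof
    show "\<Union>\<V> \<subseteq> regular_part f \<inter> f -` ball q e"
      using sub chart_image unfolding \<V>_def by blast
    show "regular_part f \<inter> f -` ball q e \<subseteq> \<Union>\<V>"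
      using d(2)[OF e(1,2)] unfolding \<V>_def regular_part_eq by blast
  qed
  have conn: "connected N" if N: "branched_chart f q e N c" for N c
  proof -
    obtain g where "homeomorphism N (ball q e) f g"
      using chart_homeomorphism[OF N regular_chart_at[OF N q]] by blast
    then have "N homeomorphic ball q e" unfolding homeomorphic_def by blast
    then show ?thesis using homeomorphic_connectedness connected_ball by blast
  qed
  have le: "N1 \<subseteq> N2"
    if N1: "branched_chart f q e N1 c1" and N2: "branched_chart f q e N2 c2" and "N1 \<inter> N2 \<noteq> {}"
    for N1 N2 c1 c2
    by (rule chart_traps_connected[OF N2 conn[OF N1] chart_subset[OF N1]])
       (use chart_image[OF N1] that(3) in blast)+
  show "\<exists>T. q \<in> T \<and> openin (top_of_set regular_values) T \<and>
          (\<exists>v. \<Union>v = regular_part f \<inter> f -` T \<and> (\<forall>u\<in>v. openin (top_of_set (regular_part f)) u) \<and>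
            pairwise disjnt v \<and> (\<forall>u\<in>v. \<exists>g. homeomorphism u T f g))"
  proof (intro exI[of _ "ball q e"] exI[of _ \<V>] conjI ballI)
    show "q \<in> ball q e" using e(1) by simp
    show "openin (top_of_set regular_values) (ball q e)"
      using e(3) by (simp add: open_openin_trans open_regular_values)
    show "\<Union>\<V> = regular_part f \<inter> f -` ball q e" by (rule U)
    show "openin (top_of_set (regular_part f)) N" if NV: "N \<in> \<V>" for N
    proof -
      obtain c where N: "branched_chart f q e N c" using NV unfolding \<V>_def by blast
      show ?thesis
        using chart_open[OF N] sub[OF N] open_regular_part by (simp add: open_openin_trans)
    qed
    show "\<exists>g. homeomorphism N (ball q e) f g" if NV: "N \<in> \<V>" for N
    proof -
      obtain c where N: "branched_chart f q e N c" using NV unfolding \<V>_def by blast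
      show ?thesis using chart_homeomorphism[OF N regular_chart_at[OF N q]] .
    qed
    show "pairwise disjnt \<V>"
    proof (rule pairwiseI)
      fix N1 N2 assume "N1 \<in> \<V>" "N2 \<in> \<V>" "N1 \<noteq> N2"
      then obtain c1 c2 where N: "branched_chart f q e N1 c1" "branched_chart f q e N2 c2"
        unfolding \<V>_def by blast
      show "disjnt N1 N2"
      proof (rule ccontr)
        assume "\<not> disjnt N1 N2"
        then have "N1 \<inter> N2 \<noteq> {}" "N2 \<inter> N1 \<noteq> {}" unfolding disjnt_def by blast+
        then have "N1 \<subseteq> N2" "N2 \<subseteq> N1" using le N by blast+
        then show False using \<open>N1 \<noteq> N2\<close> by blast
      qed
    qed
  qed
qed

text \<open>Continuous right inverses of \<open>f\<close>; over subsets of the regular values these are the lifts of the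
  inclusion through the covering.\<close>

definition is_section :: "complex set \<Rightarrow> (complex \<Rightarrow> complex) \<Rightarrow> bool"
  where "is_section T g \<longleftrightarrow> continuous_on T g \<and> g ` T \<subseteq> \<D> \<and> (\<forall>q\<in>T. f (g q) = q)"

lemma section_in_regular_part:
  "is_section T g \<Longrightarrow> T \<subseteq> regular_values \<Longrightarrow> q \<in> T \<Longrightarrow> g q \<in> regular_part f"
  unfolding is_section_def regular_part_eq by auto

lemma section_through:
  assumes T: "simply_connected T" "locally path_connected T" "T \<subseteq> regular_values"
    and z: "z \<in> \<D>" "f z \<in> T"
  shows "\<exists>g. is_section T g \<and> g (f z) = z"
proof -
  have "z \<in> regular_part f" using z T(3) unfolding regular_part_eq by blast
  then obtain g where "continuous_on T g" "g \<in> T \<rightarrow> regular_part f" "g (f z) = z"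
      "\<And>y. y \<in> T \<Longrightarrow> f (g y) = y"
    using covering_space_lift_strong[OF covering, of z "f z" T "\<lambda>q. q"] z(2) T
    by (metis Pi_I continuous_on_id subsetD)
  then show ?thesis
    unfolding is_section_def regular_part_def by blast
qed

lemma section_unique:
  assumes T: "connected T" "T \<subseteq> regular_values" and g: "is_section T g1" "is_section T g2"
    and eq: "a \<in> T" "g1 a = g2 a" and x: "x \<in> T"
  shows "g1 x = g2 x"
proof -
  have "g1 \<in> T \<rightarrow> regular_part f" "g2 \<in> T \<rightarrow> regular_part f"
    using section_in_regular_part[OF _ T(2)] g by blast+
  moreover have "continuous_on T g1" "continuous_on T g2" "\<And>y. y \<in> T \<Longrightarrow> y = f (g1 y)"
      "\<And>y. y \<in> T \<Longrightarrow> y = f (g2 y)"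
    using g unfolding is_section_def by auto
  ultimately show ?thesis
    using covering_space_lift_unique[OF covering, of g1 a g2 T "\<lambda>q. q" x] assms
    by (simp add: Pi_iff subset_eq)
qed

end

section \<open>Gluing by means of a slit disk\<close>

lemma closed_segment_open_neighbourhood:
  fixes p q :: "'a::euclidean_space"
  assumes "open W" "closed_segment p q \<subseteq> W"
  shows "\<exists>d>0. \<forall>q'\<in>ball q d. closed_segment p q' \<subseteq> W"
proof -
  obtain d where d: "d > 0" "(\<Union>x\<in>closed_segment p q. ball x d) \<subseteq> W"
    using compact_subset_open_imp_ball_epsilon_subset[OF compact_segment(1) assms] .
  have "closed_segment p q' \<subseteq> W" if q': "q' \<in> ball q d" for q'
  proof
    fix y assume "y \<in> closed_segment p q'"
    then obtain s where s: "0 \<le> s" "s \<le> 1" "y = (1 - s) *\<^sub>R p + s *\<^sub>R q'"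
      by (auto simp: in_segment)
    define x where "x = (1 - s) *\<^sub>R p + s *\<^sub>R q"
    have "x - y = s *\<^sub>R (q - q')" unfolding x_def s(3) by (simp add: algebra_simps)
    then have "dist x y = s * dist q q'" using s(1) by (simp add: dist_norm)
    also have "\<dots> \<le> dist q q'" using s by (simp add: mult_left_le_one_le)
    finally have "y \<in> ball x d" using q' by simp
    moreover have "x \<in> closed_segment p q" unfolding x_def in_segment using s by blast
    ultimately show "y \<in> W" using d(2) by blast
  qed
  then show ?thesis using d(1) by blast
qed

text \<open>Lifts of a path ending at a critical value exist only on the half-open interval; this closes
  them up.\<close>

lemma path_with_limit_endpoint:
  fixes h :: "real \<Rightarrow> 'a::topological_space"
  assumes h: "continuous_on {0..<1} h" and lim: "(h \<longlongrightarrow> c) (at_left 1)"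
  shows "path (\<lambda>t. if t < 1 then h t else c)"
  unfolding path_def continuous_on_eq_continuous_within
proof
  fix t :: real assume t: "t \<in> {0..1}"
  let ?s = "\<lambda>t. if t < 1 then h t else c"
  show "continuous (at t within {0..1}) ?s"
  proof (cases "t < 1")
    case True
    have "continuous_on {0..<1} ?s"
      by (rule continuous_on_eq[OF h]) simp
    then have "continuous (at t within {0..<1}) ?s"
      using t True by (simp add: continuous_on_eq_continuous_within)
    moreover have "at t within {0..<1} = at t within {0..1}"
      by (rule at_within_nhd[of t "{..<1}"]) (use True in auto)
    ultimately show ?thesis by simp
  next
    case False
    then have "t = 1" using t by simp
    have "eventually (\<lambda>t. h t = ?s t) (at_left (1::real))"
      by (simp add: eventually_at_filter)
    with lim have "(?s \<longlongrightarrow> c) (at_left 1)"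
      by (rule Lim_transform_eventually)
    then show ?thesis
      unfolding \<open>t = 1\<close> by (simp add: continuous_within at_within_Icc_at_left)
  qed
qed

text \<open>The affine coordinate that sends \<open>p\<close> to 0 and \<open>v\<close> to 1. The slit starting at \<open>v\<close> and pointing
  away from \<open>p\<close> becomes the real half-line from 1 to infinity.\<close>

definition slit_coordinate :: "complex \<Rightarrow> complex \<Rightarrow> complex \<Rightarrow> complex"
  where "slit_coordinate p v q = (q - p) / (v - p)"

lemma slit_coordinate_convex:
  "slit_coordinate p v ((1 - u) *\<^sub>R a + u *\<^sub>R b) =
     (1 - u) *\<^sub>R slit_coordinate p v a + u *\<^sub>R slit_coordinate p v b"
proof -
  have "(1 - u) *\<^sub>R a + u *\<^sub>R b - p = (1 - u) *\<^sub>R (a - p) + u *\<^sub>R (b - p)"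
    by (simp add: algebra_simps)
  then show ?thesis
    unfolding slit_coordinate_def by (simp add: add_divide_distrib scaleR_conv_of_real)
qed

lemma mem_segment_iff_slit_coordinate:
  assumes "v \<noteq> p"
  shows "v \<in> closed_segment p q \<longleftrightarrow>
    Im (slit_coordinate p v q) = 0 \<and> 1 \<le> Re (slit_coordinate p v q)"
proof
  assume "v \<in> closed_segment p q"
  then obtain s where s: "0 \<le> s" "s \<le> 1" "v = (1 - s) *\<^sub>R p + s *\<^sub>R q"
    by (auto simp: in_segment)
  have "s \<noteq> 0" using s assms by auto
  have vp: "v - p = of_real s * (q - p)"
    unfolding s(3) by (simp add: algebra_simps scaleR_conv_of_real)
  then have "q \<noteq> p" using assms by auto
  have "slit_coordinate p v q = of_real (1 / s)"
    unfolding slit_coordinate_def vp using \<open>s \<noteq> 0\<close> \<open>q \<noteq> p\<close> by simp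
  then show "Im (slit_coordinate p v q) = 0 \<and> 1 \<le> Re (slit_coordinate p v q)"
    using s \<open>s \<noteq> 0\<close> by simp
next
  define r where "r = Re (slit_coordinate p v q)"
  assume "Im (slit_coordinate p v q) = 0 \<and> 1 \<le> Re (slit_coordinate p v q)"
  then have "slit_coordinate p v q = of_real r" "1 \<le> r"
    unfolding r_def by (auto simp: complex_eq_iff)
  then have "q - p = of_real r * (v - p)"
    using assms unfolding slit_coordinate_def by (simp add: divide_eq_eq)
  then have "v - p = of_real (1 / r) * (q - p)" using \<open>1 \<le> r\<close> by simp
  then have "v = (1 - 1 / r) *\<^sub>R p + (1 / r) *\<^sub>R q"
    by (simp add: algebra_simps scaleR_conv_of_real diff_divide_distrib)
  then show "v \<in> closed_segment p q"
    unfolding in_segment using \<open>1 \<le> r\<close> by (intro exI[of _ "1 / r"]) auto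
qed

lemma glued_refl: "z \<in> regular_part \<psi> \<Longrightarrow> glued \<psi> z z"
  unfolding glued_def by (rule tranclp.r_into_trancl) (simp add: directly_glued_def)

lemma glued_trans: "glued \<psi> x y \<Longrightarrow> glued \<psi> y z \<Longrightarrow> glued \<psi> x z"
  unfolding glued_def by (rule tranclp_trans)

lemma directly_glued_imp_glued: "directly_glued \<psi> x y \<Longrightarrow> glued \<psi> x y"
  unfolding glued_def by (rule tranclp.r_into_trancl)

text \<open>The centre \<open>p\<close> is generic: no ray from \<open>p\<close> contains two critical values. The base value \<open>p0\<close>
  whose fibre is to be glued is kept separate from \<open>p\<close>, because it cannot be assumed to be generic.\<close>

locale slit_disk = branched_disk_covering +
  fixes p p0 :: complex
  assumes p0_visible: "closed_segment p p0 \<subseteq> regular_values"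
    and generic: "\<lbrakk>u \<in> critical_values; v \<in> critical_values;
      u \<in> closed_segment p q; v \<in> closed_segment p q\<rbrakk> \<Longrightarrow> u = v"
begin

text \<open>The values visible from \<open>p\<close>: the disk with a slit removed behind every critical value.\<close>

definition star :: "complex set"
  where "star = {q. closed_segment p q \<subseteq> regular_values}"

definition over_star :: "complex set"
  where "over_star = {z \<in> \<D>. f z \<in> star}"

text \<open>The label of the sheet through \<open>z\<close>: follow the section through \<open>z\<close> to the point over \<open>p0\<close>.
  It is meaningful for \<open>z\<close> over \<open>star\<close>.\<close>

definition base :: "complex \<Rightarrow> complex"
  where "base z = (SOME a. \<exists>g. is_section star g \<and> g (f z) = z \<and> g p0 = a)"

abbreviation slit :: "complex \<Rightarrow> complex \<Rightarrow> complex"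
  where "slit \<equiv> slit_coordinate p"

lemma p_regular: "p \<in> regular_values"
  using p0_visible by auto

lemma p_disk: "p \<in> \<D>"
  using p_regular by (simp add: regular_values_def)

lemma p_not_critical: "v \<in> critical_values \<Longrightarrow> v \<noteq> p"
  using p_regular by (auto simp: regular_values_def)

lemma p0_star: "p0 \<in> star"
  using p0_visible by (simp add: star_def)

lemma p_star: "p \<in> star"
  using p_regular by (simp add: star_def)

lemma star_regular: "star \<subseteq> regular_values"
  unfolding star_def by auto

lemma segment_star: "q \<in> star \<Longrightarrow> closed_segment p q \<subseteq> star"
  unfolding star_def using subset_closed_segment[of p _ p q] by blast

lemma open_star: "open star"
  unfolding open_contains_ball
proof
  fix q assume "q \<in> star"
  then obtain d where "d > 0" "\<forall>q'\<in>ball q d. closed_segment p q' \<subseteq> regular_values"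
    using closed_segment_open_neighbourhood[OF open_regular_values] unfolding star_def by blast
  then show "\<exists>e>0. ball q e \<subseteq> star" unfolding star_def by blast
qed

lemma starlike_star: "starlike star"
  unfolding starlike_def using p_star segment_star by blast

lemma connected_star: "connected star"
  by (rule starlike_imp_connected[OF starlike_star])

lemma section_star: "z \<in> over_star \<Longrightarrow> \<exists>g. is_section star g \<and> g (f z) = z"
  unfolding over_star_def
  by (intro section_through starlike_imp_simply_connected starlike_star
      open_imp_locally_path_connected open_star star_regular) auto

lemma section_value:
  "is_section T g \<Longrightarrow> q \<in> T \<Longrightarrow> f (g q) = q" "is_section T g \<Longrightarrow> q \<in> T \<Longrightarrow> g q \<in> \<D>"
  unfolding is_section_def by auto

lemma base_section:
  assumes g: "is_section star g" and q: "q \<in> star"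
  shows "base (g q) = g p0"
proof -
  have "\<exists>a. \<exists>h. is_section star h \<and> h (f (g q)) = g q \<and> h p0 = a"
    using g section_value(1)[OF g q] by metis
  then have "\<exists>h. is_section star h \<and> h (f (g q)) = g q \<and> h p0 = base (g q)"
    unfolding base_def by (rule someI_ex)
  then obtain h where h: "is_section star h" "h q = g q" "h p0 = base (g q)"
    unfolding section_value(1)[OF g q] by blast
  show ?thesis
    using section_unique[OF connected_star star_regular h(1) g q h(2) p0_star] h(3) by simp
qed

lemma base_regular:
  assumes "z \<in> over_star"
  shows "base z \<in> regular_part f" "f (base z) = p0"
proof -
  obtain g where g: "is_section star g" "g (f z) = z"
    using section_star[OF assms] by blast
  have b: "base z = g p0"
    using base_section[OF g(1), of "f z"] g(2) assms by (simp add: over_star_def)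
  show "base z \<in> regular_part f" "f (base z) = p0"
    unfolding b using section_in_regular_part[OF g(1) star_regular p0_star]
      section_value(1)[OF g(1) p0_star] by blast+
qed

lemma base_self: "z \<in> \<D> \<Longrightarrow> f z = p0 \<Longrightarrow> z \<in> over_star \<and> base z = z"
  using base_section section_star[of z] p0_star unfolding over_star_def by force

lemma section_stays_in_chart:
  assumes N: "branched_chart f q e N c" and S: "connected S" "S \<subseteq> star \<inter> ball q e"
    and g: "is_section star g" and x: "x \<in> S" "g x \<in> N"
  shows "g ` S \<subseteq> N"
proof (rule chart_traps_connected[OF N])
  have Sstar: "S \<subseteq> star" using S(2) by blast
  have "continuous_on star g" using g unfolding is_section_def by (rule conjunct1)
  then have "continuous_on S g" using Sstar by (rule continuous_on_subset)
  then show "connected (g ` S)" using S(1) by (rule connected_continuous_image)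
  show "g ` S \<subseteq> \<D>" using section_value(2)[OF g] Sstar by blast
  show "f ` g ` S \<subseteq> ball q e" using section_value(1)[OF g] S(2) by force
  show "g ` S \<inter> N \<noteq> {}" using x by blast
qed

text \<open>A section over a connected set that starts in an injective chart stays in it and so passes
  through every point of the chart over that set.\<close>

lemma base_constant_over:
  assumes N: "branched_chart f q e N c" "inj_on f N" and S: "connected S" "S \<subseteq> star \<inter> ball q e"
    and z: "z1 \<in> N" "z2 \<in> N" "f z1 \<in> S" "f z2 \<in> S"
  shows "base z1 = base z2"
proof -
  have "z1 \<in> over_star"
    using z S(2) chart_subset[OF N(1)] unfolding over_star_def by blast
  then obtain g where g: "is_section star g" "g (f z1) = z1" using section_star by blast
  have "g ` S \<subseteq> N"
    by (rule section_stays_in_chart[OF N(1) S g(1) z(3)]) (simp add: g(2) z(1))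
  then have "g (f z2) \<in> N" using z(4) by blast
  moreover have "f (g (f z2)) = f z2" using section_value(1)[OF g(1)] z(4) S(2) by blast
  ultimately have "g (f z2) = z2" using N(2) z(2) by (simp add: inj_on_eq_iff)
  moreover have "f z1 \<in> star" "f z2 \<in> star" using z(3,4) S(2) by blast+
  ultimately show ?thesis
    using base_section[OF g(1), of "f z1"] base_section[OF g(1), of "f z2"] g(2) by simp
qed

text \<open>Behind the critical value \<open>v\<close> the only obstruction to visibility is the slit of \<open>v\<close>: by
  genericity the segment from \<open>p\<close> to \<open>q\<close> contains no other critical value, and by compactness nearby
  segments avoid the other critical values as well.\<close>

lemma star_near:
  assumes q: "q \<in> \<D>" and v: "v \<in> critical_values" "v \<in> closed_segment p q"
  shows "\<exists>d>0. \<forall>x\<in>ball q d. x \<in> star \<longleftrightarrow> \<not> (Im (slit v x) = 0 \<and> 1 \<le> Re (slit v x))"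
proof -
  have vD: "v \<in> \<D>" "v \<notin> regular_values"
    using v in_disk unfolding critical_values_def regular_values_def by auto
  have seg: "closed_segment p q \<subseteq> \<D>"
    using p_disk q by (simp add: closed_segment_subset)
  have "closed_segment p q \<subseteq> insert v regular_values"
  proof
    fix x assume x: "x \<in> closed_segment p q"
    show "x \<in> insert v regular_values"
      using generic[OF _ v(1) x v(2)] x seg unfolding regular_values_def by blast
  qed
  then obtain d where d: "d > 0" "\<forall>x\<in>ball q d. closed_segment p x \<subseteq> insert v regular_values"
    using closed_segment_open_neighbourhood[OF open_regular_insert[OF vD(1)]] by blast
  have "x \<in> star \<longleftrightarrow> \<not> (Im (slit v x) = 0 \<and> 1 \<le> Re (slit v x))" if x: "x \<in> ball q d" for x
  proof -
    have "x \<in> star \<longleftrightarrow> v \<notin> closed_segment p x"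
      using d(2) x vD(2) unfolding star_def by blast
    then show ?thesis
      using mem_segment_iff_slit_coordinate[OF p_not_critical[OF v(1)]] by simp
  qed
  then show ?thesis using d(1) by blast
qed

lemma segment_to_critical_value:
  assumes v: "v \<in> critical_values" and t: "0 \<le> t" "t < 1"
  shows "linepath p v t \<in> star"
proof -
  have vD: "v \<in> \<D>" "v \<noteq> p"
    using v in_disk p_not_critical unfolding critical_values_def by auto
  define x where "x = linepath p v t"
  have xs: "x \<in> closed_segment p v"
    unfolding x_def using t linepath_in_path[of t p v] by simp
  have "slit v x = (1 - t) *\<^sub>R slit v p + t *\<^sub>R slit v v"
    unfolding x_def linepath_def by (rule slit_coordinate_convex)
  then have "slit v x = of_real t"
    using vD(2) by (simp add: slit_coordinate_def scaleR_conv_of_real)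
  then have nv: "v \<notin> closed_segment p x"
    unfolding mem_segment_iff_slit_coordinate[OF vD(2)] using t by simp
  have sub: "closed_segment p x \<subseteq> closed_segment p v"
    using xs by (simp add: subset_closed_segment)
  have "closed_segment p v \<subseteq> \<D>"
    using p_disk vD by (simp add: closed_segment_subset)
  moreover have "y \<notin> critical_values" if "y \<in> closed_segment p x" for y
    using generic[OF _ v, of y v] that sub nv by auto
  ultimately have "closed_segment p x \<subseteq> regular_values"
    using sub unfolding regular_values_def by blast
  then show ?thesis unfolding star_def x_def by simp
qed

text \<open>Go from \<open>p0\<close> through \<open>p\<close> straight to the critical value \<open>v\<close>. The lifts of this path to the two
  sheets are eventually trapped in the chart, so both end at its centre \<open>c\<close>; this is a direct gluing.\<close>

lemma glued_over_critical_value: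
  assumes N: "branched_chart f v e N c" and v: "v \<in> critical_values" and "0 < e"
    and S: "connected (star \<inter> ball v e)"
    and z: "z1 \<in> N" "z2 \<in> N" "z1 \<in> over_star" "z2 \<in> over_star"
  shows "glued f (base z1) (base z2)"
proof -
  define \<tau> where "\<tau> = linepath p0 p +++ linepath p v"
  have path_\<tau>: "path \<tau>" unfolding \<tau>_def by simp
  have \<tau>_star: "\<tau> t \<in> star" if t: "t \<in> {0..<1}" for t
  proof (cases "t \<le> 1/2")
    case True
    have "linepath p0 p (2 * t) \<in> closed_segment p0 p"
      using True t linepath_in_path[of "2 * t" p0 p] by simp
    then show ?thesis
      using True segment_star[OF p0_star] unfolding \<tau>_def joinpaths_def
      by (auto simp: closed_segment_commute)
  next
    case False
    then show ?thesis
      using segment_to_critical_value[OF v, of "2 * t - 1"] t unfolding \<tau>_def joinpaths_def by simp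
  qed
  have \<tau>_lim: "(\<tau> \<longlongrightarrow> v) (at_left 1)"
  proof -
    have "(\<tau> \<longlongrightarrow> \<tau> 1) (at 1 within {0..1})"
      using path_\<tau> unfolding path_def continuous_on_def by simp
    moreover have "\<tau> 1 = v" unfolding \<tau>_def joinpaths_def linepath_def by simp
    ultimately show ?thesis by (simp add: at_within_Icc_at_left)
  qed
  have ev: "eventually (\<lambda>t. t \<in> {0..<1}) (at_left (1::real))"
    using eventually_at_left_real[OF zero_less_one] by eventually_elim auto
  have ev': "eventually (\<lambda>t. \<tau> t \<in> star \<inter> ball v e) (at_left 1)"
  proof -
    have "eventually (\<lambda>t. \<tau> t \<in> ball v e) (at_left 1)"
      using \<tau>_lim by (rule topological_tendstoD) (use \<open>0 < e\<close> in auto)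
    with ev show ?thesis by eventually_elim (use \<tau>_star in blast)
  qed
  define \<sigma> where "\<sigma> g t = (if t < 1 then g (\<tau> t) else c)" for g :: "complex \<Rightarrow> complex" and t :: real
  have \<sigma>: "path (\<sigma> g)" "\<And>t. t \<in> {0..<1} \<Longrightarrow> \<sigma> g t \<in> regular_part f"
      "\<And>t. t \<in> {0..1} \<Longrightarrow> f (\<sigma> g t) = \<tau> t" "path_image (\<sigma> g) \<subseteq> \<D>"
      "pathstart (\<sigma> g) = base z" "pathfinish (\<sigma> g) = c"
    if g: "is_section star g" and gz: "g (f z) = z" and zN: "z \<in> N" and zs: "z \<in> over_star" for g z
  proof -
    have fz: "f z \<in> star \<inter> ball v e"
      using zs chart_image[OF N zN] unfolding over_star_def by blast
    have "g ` (star \<inter> ball v e) \<subseteq> N"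
      by (rule section_stays_in_chart[OF N S order_refl g fz]) (simp add: gz zN)
    then have evN: "eventually (\<lambda>t. g (\<tau> t) \<in> N) (at_left 1)"
      by (intro eventually_mono[OF ev']) blast
    have "eventually (\<lambda>t. \<tau> t = f (g (\<tau> t))) (at_left 1)"
      using ev by eventually_elim (use \<tau>_star section_value(1)[OF g] in auto)
    with \<tau>_lim have "((\<lambda>t. f (g (\<tau> t))) \<longlongrightarrow> v) (at_left 1)"
      by (rule Lim_transform_eventually)
    then have lim: "((\<lambda>t. g (\<tau> t)) \<longlongrightarrow> c) (at_left 1)"
      by (rule chart_tendsto_centre[OF N evN _ \<open>0 < e\<close>])
    have "continuous_on {0..<1} (\<lambda>t. g (\<tau> t))"
    proof (rule continuous_on_compose2[of star g])
      show "continuous_on star g" using g unfolding is_section_def by blast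
      show "continuous_on {0..<1} \<tau>"
        using path_\<tau> unfolding path_def by (rule continuous_on_subset) auto
    qed (use \<tau>_star in auto)
    then show "path (\<sigma> g)"
      unfolding \<sigma>_def using lim by (rule path_with_limit_endpoint)
    show reg: "\<sigma> g t \<in> regular_part f" if "t \<in> {0..<1}" for t
      using section_in_regular_part[OF g star_regular \<tau>_star[OF that]] that unfolding \<sigma>_def by simp
    have c: "c \<in> \<D>" "f c = v" using chart_centre[OF N] chart_subset[OF N] by auto
    have "\<tau> 1 = v" unfolding \<tau>_def joinpaths_def linepath_def by simp
    then show "f (\<sigma> g t) = \<tau> t" if "t \<in> {0..1}" for t
      using section_value(1)[OF g \<tau>_star, of t] that c unfolding \<sigma>_def by (cases "t = 1") auto
    show "path_image (\<sigma> g) \<subseteq> \<D>"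
    proof -
      have "\<sigma> g t \<in> \<D>" if "t \<in> {0..1}" for t
        using section_value(2)[OF g \<tau>_star, of t] that c unfolding \<sigma>_def by (cases "t = 1") auto
      then show ?thesis unfolding path_image_def by blast
    qed
    show "pathstart (\<sigma> g) = base z"
      using base_section[OF g, of "f z"] gz zs
      unfolding pathstart_def \<sigma>_def \<tau>_def joinpaths_def linepath_def over_star_def by simp
    show "pathfinish (\<sigma> g) = c" unfolding pathfinish_def \<sigma>_def by simp
  qed
  obtain g1 g2 where g1: "is_section star g1" "g1 (f z1) = z1" and g2: "is_section star g2" "g2 (f z2) = z2"
    using section_star z(3,4) by metis
  note s1 = \<sigma>[OF g1 z(1,3)] and s2 = \<sigma>[OF g2 z(2,4)]
  have "f (base z1) = f (base z2)" using base_regular(2) z(3,4) by simp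
  moreover have "pathfinish (\<sigma> g1) = pathfinish (\<sigma> g2)" using s1(6) s2(6) by simp
  moreover have "\<forall>t\<in>{0..1}. f (\<sigma> g1 t) = f (\<sigma> g2 t)" using s1(3) s2(3) by simp
  moreover have "\<forall>t\<in>{0..<1}. \<sigma> g1 t \<in> regular_part f \<and> \<sigma> g2 t \<in> regular_part f"
    using s1(2) s2(2) by blast
  ultimately have "directly_glued f (base z1) (base z2)"
    unfolding directly_glued_def
    using base_regular(1)[OF z(3)] base_regular(1)[OF z(4)] s1(1,4,5) s2(1,4,5) by blast
  then show ?thesis by (rule directly_glued_imp_glued)
qed

text \<open>Near such a point the gluing class of the label does not depend on the sheet.\<close>

definition locally_glued :: "complex \<Rightarrow> bool"
  where "locally_glued z \<longleftrightarrow> (\<exists>U. open U \<and> z \<in> U \<and>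
    (\<forall>x\<in>U \<inter> over_star. \<forall>y\<in>U \<inter> over_star. glued f (base x) (base y)))"

lemma locally_gluedI:
  assumes "open U" "z \<in> U"
    and "\<And>x y. x \<in> U \<Longrightarrow> y \<in> U \<Longrightarrow> x \<in> over_star \<Longrightarrow> y \<in> over_star \<Longrightarrow> glued f (base x) (base y)"
  shows "locally_glued z"
  unfolding locally_glued_def using assms by blast

lemma over_starD: "z \<in> over_star \<Longrightarrow> z \<in> \<D>" "z \<in> over_star \<Longrightarrow> f z \<in> star"
  unfolding over_star_def by blast+

lemma small_charts:
  assumes "q \<in> \<D>" "0 < \<epsilon>"
  shows "\<exists>e>0. e \<le> \<epsilon> \<and> (\<forall>z\<in>\<D>. f z \<in> ball q e \<longrightarrow> (\<exists>N c. branched_chart f q e N c \<and> z \<in> N))"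
proof -
  obtain d where d: "d > 0" "\<forall>e. 0 < e \<and> e \<le> d \<longrightarrow>
      (\<forall>z\<in>\<D>. f z \<in> ball q e \<longrightarrow> (\<exists>N c. branched_chart f q e N c \<and> z \<in> N))"
    using charts[OF assms(1)] by blast
  have "0 < min d \<epsilon>" "min d \<epsilon> \<le> d" "min d \<epsilon> \<le> \<epsilon>" using d(1) assms(2) by auto
  then show ?thesis using d(2) by blast
qed

text \<open>A disk minus a radial slit is star-shaped about a point on the opposite side of the slit.\<close>

lemma connected_star_ball:
  assumes v: "v \<in> critical_values" and "0 < e"
    and e: "\<And>x. x \<in> ball v e \<Longrightarrow> x \<in> star \<longleftrightarrow> \<not> (Im (slit v x) = 0 \<and> 1 \<le> Re (slit v x))"
  shows "connected (star \<inter> ball v e)"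
proof -
  have vp: "v \<noteq> p" using p_not_critical[OF v] .
  define t where "t = min 1 (e / (2 * norm (v - p)))"
  \<comment> \<open>The centre of the star-shaped set: a point of the ball on the segment from v to p.\<close>
  define m where "m = (1 - t) *\<^sub>R v + t *\<^sub>R p"
  have t: "0 < t" "t \<le> 1" unfolding t_def using \<open>0 < e\<close> vp by auto
  have "v - m = t *\<^sub>R (v - p)" unfolding m_def by (simp add: algebra_simps)
  then have "dist v m = t * norm (v - p)" using t by (simp add: dist_norm)
  also have "\<dots> \<le> e / (2 * norm (v - p)) * norm (v - p)"
    unfolding t_def by (intro mult_right_mono) auto
  also have "\<dots> < e" using vp \<open>0 < e\<close> by simp
  finally have m_ball: "m \<in> ball v e" by simp
  have slit_m: "slit v m = of_real (1 - t)"
    unfolding m_def slit_coordinate_convex using vp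
    by (simp add: slit_coordinate_def scaleR_conv_of_real)
  have m_star: "m \<in> star" using e[OF m_ball] t slit_m by simp
  have "closed_segment m x \<subseteq> star \<inter> ball v e" if x: "x \<in> star \<inter> ball v e" for x
  proof
    fix y assume y: "y \<in> closed_segment m x"
    have yb: "y \<in> ball v e"
      using y x m_ball closed_segment_subset[OF _ _ convex_ball, of m v e x] by blast
    obtain u where u: "0 \<le> u" "u \<le> 1" "y = (1 - u) *\<^sub>R m + u *\<^sub>R x"
      using y by (auto simp: in_segment)
    have im: "Im (slit v y) = u * Im (slit v x)"
      and re: "Re (slit v y) = (1 - u) * (1 - t) + u * Re (slit v x)"
      unfolding u(3) slit_coordinate_convex slit_m by simp_all
    have "Re (slit v y) < 1" if "Im (slit v y) = 0"
    proof (cases "u = 0")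
      case True
      then show ?thesis using re t by simp
    next
      case False
      then have "Im (slit v x) = 0" using im that by simp
      then have "Re (slit v x) < 1" using e[of x] x by auto
      then have "u * Re (slit v x) < u * 1" using False u(1) by (intro mult_strict_left_mono) auto
      moreover have "(1 - u) * (1 - t) \<le> (1 - u) * 1" using u t by (intro mult_left_mono) auto
      ultimately show ?thesis using re by simp
    qed
    then have "y \<in> star" using e[OF yb] by auto
    then show "y \<in> star \<inter> ball v e" using yb by blast
  qed
  then have "starlike (star \<inter> ball v e)"
    unfolding starlike_def using m_ball m_star by blast
  then show ?thesis by (rule starlike_imp_connected)
qed

lemma locally_glued_near_critical_value:
  assumes v: "v \<in> critical_values"
  shows "\<exists>e>0. \<forall>z\<in>\<D>. f z \<in> ball v e \<longrightarrow> locally_glued z"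
proof -
  have vD: "v \<in> \<D>" using v in_disk unfolding critical_values_def by auto
  have "v \<in> closed_segment p v" by simp
  then obtain d where d: "d > 0" "\<forall>x\<in>ball v d. x \<in> star \<longleftrightarrow> \<not> (Im (slit v x) = 0 \<and> 1 \<le> Re (slit v x))"
    using star_near[OF vD v] by blast
  obtain e where e: "e > 0" "e \<le> d"
      "\<forall>z\<in>\<D>. f z \<in> ball v e \<longrightarrow> (\<exists>N c. branched_chart f v e N c \<and> z \<in> N)"
    using small_charts[OF vD d(1)] by blast
  have conn: "connected (star \<inter> ball v e)"
    by (rule connected_star_ball[OF v e(1)]) (use d(2) e(2) in auto)
  have "locally_glued z" if z: "z \<in> \<D>" "f z \<in> ball v e" for z
  proof -
    obtain N c where N: "branched_chart f v e N c" "z \<in> N" using e(3) z by blast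
    show ?thesis
      by (rule locally_gluedI[OF chart_open[OF N(1)] N(2)])
         (rule glued_over_critical_value[OF N(1) v e(1) conn])
  qed
  then show ?thesis using e(1) by blast
qed

lemma locally_glued_over_star:
  assumes "z \<in> over_star"
  shows "locally_glued z"
proof -
  note z = over_starD[OF assms]
  obtain d where d: "d > 0" "ball (f z) d \<subseteq> star" using open_star z(2) by (metis openE)
  obtain e where e: "e > 0" "e \<le> d"
      "\<forall>x\<in>\<D>. f x \<in> ball (f z) e \<longrightarrow> (\<exists>N c. branched_chart f (f z) e N c \<and> x \<in> N)"
    using small_charts[OF in_disk[OF z(1)] d(1)] by blast
  obtain N c where N: "branched_chart f (f z) e N c" "z \<in> N" using e(1,3) z(1) by (metis centre_in_ball)
  have inj: "inj_on f N"
    using chart_inj[OF N(1)] regular_chart_at[OF N(1)] z(2) star_regular by blast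
  have sub: "ball (f z) e \<subseteq> star \<inter> ball (f z) e"
    using d(2) e(2) by (meson subset_ball Int_greatest order_refl order_trans)
  show ?thesis
  proof (rule locally_gluedI[OF chart_open[OF N(1)] N(2)])
    fix x y assume "x \<in> N" "y \<in> N" and x: "x \<in> over_star" and "y \<in> over_star"
    then have "base x = base y"
      by (intro base_constant_over[OF N(1) inj connected_ball sub]) (use chart_image[OF N(1)] in blast)+
    then show "glued f (base x) (base y)"
      using glued_refl base_regular(1)[OF x] by simp
  qed
qed

lemma slit_shift:
  assumes "v \<noteq> p"
  shows "slit v (x + of_real \<eta> * \<i> * (v - p)) = slit v x + of_real \<eta> * \<i>"
proof -
  have "x + of_real \<eta> * \<i> * (v - p) - p = (x - p) + of_real \<eta> * \<i> * (v - p)" by simp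
  then show ?thesis
    using assms unfolding slit_coordinate_def by (simp only: add_divide_distrib) simp
qed

lemma shift_in_open:
  assumes "open W" "(x::complex) \<in> W"
  shows "\<exists>\<eta>>0. x + of_real \<eta> * \<i> * w \<in> W \<and> x + of_real (- \<eta>) * \<i> * w \<in> W"
proof -
  obtain r where r: "r > 0" "ball x r \<subseteq> W" using assms by (metis openE)
  define k where "k = norm w + 1"
  have k: "k > 0" "norm w \<le> k" unfolding k_def by (simp_all add: add_nonneg_pos)
  define \<eta> where "\<eta> = r / (2 * k)"
  have \<eta>: "\<eta> > 0" unfolding \<eta>_def using r(1) k(1) by simp
  have "\<eta> * norm w \<le> \<eta> * k" using \<eta> k(2) by simp
  also have "\<dots> = r / 2" unfolding \<eta>_def using k(1) by simp
  also have "\<dots> < r" using r(1) by simp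
  finally have *: "\<eta> * norm w < r" .
  have "x + of_real \<eta> * \<i> * w \<in> ball x r" "x + of_real (- \<eta>) * \<i> * w \<in> ball x r"
    using * \<eta> by (simp_all add: dist_norm norm_mult)
  then show ?thesis using \<eta> r(2) by blast
qed

text \<open>Across a slit, at a regular value \<open>q\<close> behind \<open>v\<close>, a chart carries only two labels, one for each
  side of the slit. If they are glued near one point of the chart over the slit, they are glued on the
  whole chart.\<close>

lemma locally_glued_propagates:
  assumes q: "q \<in> regular_values" and v: "v \<in> critical_values" "v \<in> closed_segment p q"
  shows "\<exists>e>0. \<forall>z\<in>\<D>. f z \<in> ball q e \<longrightarrow> (\<exists>N c. branched_chart f q e N c \<and> z \<in> N \<and>
    (\<forall>x\<in>N. \<forall>y\<in>N. v \<in> closed_segment p (f x) \<longrightarrow> locally_glued x \<longrightarrow> locally_glued y))"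
proof -
  have qD: "q \<in> \<D>" and qv: "q \<noteq> v"
    using q v unfolding regular_values_def by auto
  have vp: "v \<noteq> p" using p_not_critical[OF v(1)] .
  obtain d where d: "d > 0" "\<forall>x\<in>ball q d. x \<in> star \<longleftrightarrow> \<not> (Im (slit v x) = 0 \<and> 1 \<le> Re (slit v x))"
    using star_near[OF qD v] by blast
  \<comment> \<open>Keeping the disk away from v leaves only the condition on the imaginary part.\<close>
  obtain e where e: "e > 0" "e \<le> d" "e \<le> dist q v"
    and ch: "\<forall>z\<in>\<D>. f z \<in> ball q e \<longrightarrow> (\<exists>N c. branched_chart f q e N c \<and> z \<in> N)"
    using small_charts[OF qD, of "min d (dist q v)"] d(1) qv by (auto simp: min_le_iff_disj)
  have slit_q: "Im (slit v q) = 0" "1 \<le> Re (slit v q)"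
    using v(2) mem_segment_iff_slit_coordinate[OF vp] by auto
  have re: "1 < Re (slit v x)" if x: "x \<in> ball q e" for x
  proof -
    have "slit v q - slit v x = (q - x) / (v - p)" "slit v q - 1 = (q - v) / (v - p)"
      using vp by (simp_all add: slit_coordinate_def diff_divide_distrib[symmetric] divide_diff_eq_iff)
    then have "norm (slit v q - slit v x) < norm (slit v q - 1)"
      using x e(3) vp by (simp add: norm_divide divide_strict_right_mono dist_norm)
    moreover have "slit v q - 1 = of_real (Re (slit v q) - 1)"
      using slit_q by (simp add: complex_eq_iff)
    then have "norm (slit v q - 1) = Re (slit v q) - 1"
      using slit_q(2) by (metis abs_of_nonneg diff_ge_0_iff_ge norm_of_real)
    moreover have "Re (slit v q) - Re (slit v x) \<le> norm (slit v q - slit v x)"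
      using complex_Re_le_cmod[of "slit v q - slit v x"] by simp
    ultimately show ?thesis by linarith
  qed
  have star_iff: "x \<in> star \<longleftrightarrow> Im (slit v x) \<noteq> 0" if x: "x \<in> ball q e" for x
    using d(2) x e(2) re[OF x] by auto
  \<comment> \<open>The two half-disks, for s = 1 and s = -1.\<close>
  define H where "H s = {x \<in> ball q e. 0 < s * Im (slit v x)}" for s :: real
  have H: "connected (H s)" "H s \<subseteq> star \<inter> ball q e" for s
  proof -
    show "H s \<subseteq> star \<inter> ball q e" using star_iff unfolding H_def by auto
    have "convex (H s)"
      unfolding convex_alt
    proof (intro ballI allI impI)
      fix a b u assume ab: "a \<in> H s" "b \<in> H s" and u: "0 \<le> u \<and> (u::real) \<le> 1"
      have "(1 - u) *\<^sub>R a + u *\<^sub>R b \<in> ball q e"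
        using convex_ball[of q e] ab u unfolding convex_alt H_def by blast
      moreover have "s * Im (slit v ((1 - u) *\<^sub>R a + u *\<^sub>R b)) =
          (1 - u) * (s * Im (slit v a)) + u * (s * Im (slit v b))"
        unfolding slit_coordinate_convex by (simp add: algebra_simps)
      moreover have "0 < (1 - u) * (s * Im (slit v a)) + u * (s * Im (slit v b))"
      proof (cases "u = 0")
        case False
        have "0 < s * Im (slit v a)" "0 < s * Im (slit v b)" using ab unfolding H_def by auto
        then have "0 \<le> (1 - u) * (s * Im (slit v a))" "0 < u * (s * Im (slit v b))"
          using False u by (auto intro: mult_nonneg_nonneg mult_pos_pos)
        then show ?thesis by linarith
      qed (use ab in \<open>simp add: H_def\<close>)
      ultimately show "(1 - u) *\<^sub>R a + u *\<^sub>R b \<in> H s" unfolding H_def by simp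
    qed
    then show "connected (H s)" by (rule convex_connected)
  qed
  have "locally_glued y"
    if N: "branched_chart f q e N c" and x: "x \<in> N" and y: "y \<in> N"
      and seg: "v \<in> closed_segment p (f x)" and lx: "locally_glued x" for N c x y
  proof -
    have reg: "deriv f c \<noteq> 0" by (rule regular_chart_at[OF N q])
    note inj = chart_inj[OF N reg]
    obtain U where U: "open U" "x \<in> U"
        "\<forall>a\<in>U \<inter> over_star. \<forall>b\<in>U \<inter> over_star. glued f (base a) (base b)"
      using lx unfolding locally_glued_def by blast
    have "open (f ` (U \<inter> N))"
      using U(1) chart_open[OF N] chart_subset[OF N] by (intro open_image) auto
    moreover have "f x \<in> f ` (U \<inter> N)" using U(2) x by blast
    ultimately obtain \<eta> where \<eta>: "\<eta> > 0" "f x + of_real \<eta> * \<i> * (v - p) \<in> f ` (U \<inter> N)"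
        "f x + of_real (- \<eta>) * \<i> * (v - p) \<in> f ` (U \<inter> N)"
      using shift_in_open by blast
    obtain a where a: "a \<in> U" "a \<in> N" "f a = f x + of_real \<eta> * \<i> * (v - p)"
      using \<eta>(2) by (elim imageE IntE) simp
    obtain b where b: "b \<in> U" "b \<in> N" "f b = f x + of_real (- \<eta>) * \<i> * (v - p)"
      using \<eta>(3) by (elim imageE IntE) simp
    have "Im (slit v (f x)) = 0" using seg mem_segment_iff_slit_coordinate[OF vp] by simp
    then have im: "Im (slit v (f a)) = \<eta>" "Im (slit v (f b)) = - \<eta>"
      unfolding a(3) b(3) slit_shift[OF vp] by simp_all
    have ab_ball: "f a \<in> ball q e" "f b \<in> ball q e" using chart_image[OF N] a b by blast+
    have ab_over: "a \<in> over_star" "b \<in> over_star"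
      using star_iff[OF ab_ball(1)] star_iff[OF ab_ball(2)] im \<eta>(1) chart_subset[OF N] a(2) b(2)
      unfolding over_star_def by auto
    have side: "base z = base a \<or> base z = base b" if z: "z \<in> N" "z \<in> over_star" for z
    proof -
      have zb: "f z \<in> ball q e" by (rule chart_image[OF N z(1)])
      then have "Im (slit v (f z)) \<noteq> 0" using star_iff over_starD(2)[OF z(2)] by blast
      then consider "0 < Im (slit v (f z))" | "Im (slit v (f z)) < 0" by linarith
      then show ?thesis
      proof cases
        case 1
        then have "f z \<in> H 1" "f a \<in> H 1" using zb ab_ball im \<eta>(1) unfolding H_def by auto
        then have "base z = base a" by (rule base_constant_over[OF N inj H z(1) a(2)])
        then show ?thesis ..
      next
        case 2
        then have "f z \<in> H (-1)" "f b \<in> H (-1)" using zb ab_ball im \<eta>(1) unfolding H_def by auto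
        then have "base z = base b" by (rule base_constant_over[OF N inj H z(1) b(2)])
        then show ?thesis ..
      qed
    qed
    show ?thesis
    proof (rule locally_gluedI[OF chart_open[OF N] y])
      fix z1 z2 assume "z1 \<in> N" "z2 \<in> N" "z1 \<in> over_star" "z2 \<in> over_star"
      then have "base z1 \<in> {base a, base b}" "base z2 \<in> {base a, base b}" using side by blast+
      moreover have "a \<in> U \<inter> over_star" "b \<in> U \<inter> over_star" using a b ab_over by auto
      then have "glued f (base u) (base w)" if "u \<in> {a, b}" "w \<in> {a, b}" for u w
        using U(3) that by blast
      ultimately show "glued f (base z1) (base z2)" by auto
    qed
  qed
  then have "\<forall>z\<in>\<D>. f z \<in> ball q e \<longrightarrow> (\<exists>N c. branched_chart f q e N c \<and> z \<in> N \<and>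
      (\<forall>x\<in>N. \<forall>y\<in>N. v \<in> closed_segment p (f x) \<longrightarrow> locally_glued x \<longrightarrow> locally_glued y))"
    using ch by blast
  then show ?thesis using e(1) by blast
qed

text \<open>Lift the part of the slit between \<open>v\<close> and \<open>f z\<close>, starting at \<open>z\<close>. Near \<open>v\<close> the lift enters the
  region where local gluing is known, and from there the property propagates along the lift back
  to \<open>z\<close>.\<close>

lemma locally_glued_on_slit:
  assumes z: "z \<in> \<D>" "f z \<in> regular_values"
    and v: "v \<in> critical_values" "v \<in> closed_segment p (f z)"
  shows "locally_glued z"
proof -
  have vp: "v \<noteq> p" using p_not_critical[OF v(1)] .
  have fzv: "f z \<noteq> v" using z(2) v(1) unfolding regular_values_def by auto
  define q where "q s = (1 - s) *\<^sub>R v + s *\<^sub>R f z" for s :: real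
  have q_seg: "q s \<in> closed_segment p (f z)" if "s \<in> {0<..1}" for s
  proof -
    have "q s \<in> closed_segment v (f z)" unfolding q_def in_segment using that by (intro exI[of _ s]) simp
    then show ?thesis using v(2) subset_closed_segment[of v "f z" p "f z"] by auto
  qed
  have q_slit: "v \<in> closed_segment p (q s)" if s: "s \<in> {0<..1}" for s
  proof -
    have im: "Im (slit v (f z)) = 0" and re: "1 \<le> Re (slit v (f z))"
      using v(2) mem_segment_iff_slit_coordinate[OF vp] by auto
    have eq: "slit v (q s) = (1 - s) *\<^sub>R 1 + s *\<^sub>R slit v (f z)"
      unfolding q_def slit_coordinate_convex using vp by (simp add: slit_coordinate_def)
    have "s * 1 \<le> s * Re (slit v (f z))" using s re by (intro mult_left_mono) auto
    then show ?thesis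
      unfolding mem_segment_iff_slit_coordinate[OF vp] eq using im by simp
  qed
  have q_reg: "q s \<in> regular_values" if s: "s \<in> {0<..1}" for s
  proof -
    have "q s \<in> \<D>"
      using q_seg[OF s] closed_segment_subset[OF p_disk in_disk[OF z(1)] convex_ball] by blast
    moreover have "q s \<notin> critical_values"
    proof
      assume "q s \<in> critical_values"
      then have "q s = v" using generic[OF _ v(1) q_seg[OF s] v(2)] by blast
      then have "s *\<^sub>R (f z - v) = 0" unfolding q_def by (simp add: algebra_simps)
      then show False using s fzv by simp
    qed
    ultimately show ?thesis unfolding regular_values_def by blast
  qed
  have q_cont: "continuous_on A q" for A
    unfolding q_def by (intro continuous_intros)
  have zr: "z \<in> regular_part f" using z unfolding regular_part_eq by blast
  obtain h where h: "continuous_on {0<..1} h" "h \<in> {0<..1} \<rightarrow> regular_part f" "h 1 = z"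
      "\<And>s. s \<in> {0<..1} \<Longrightarrow> f (h s) = q s"
  proof (rule covering_space_lift_strong[OF covering zr, of 1 "{0<..1}" q])
    show "simply_connected {0<..1::real}" by (rule convex_imp_simply_connected) simp
    show "locally path_connected {0<..1::real}" by (rule convex_imp_locally_path_connected) simp
    show "q \<in> {0<..1} \<rightarrow> regular_values" using q_reg by blast
    show "q 1 = f z" unfolding q_def by simp
  qed (use q_cont in auto)
  have hD: "h s \<in> \<D>" if "s \<in> {0<..1}" for s
    using h(2) that unfolding regular_part_def by blast
  obtain e where e: "e > 0" "\<forall>x\<in>\<D>. f x \<in> ball v e \<longrightarrow> locally_glued x"
    using locally_glued_near_critical_value[OF v(1)] by blast
  define s1 where "s1 = min 1 (e / (2 * dist v (f z)))"
  have s0: "s1 \<in> {0<..1}" unfolding s1_def using e(1) fzv by auto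
  have "locally_glued (h s1)"
  proof -
    have "v - q s1 = s1 *\<^sub>R (v - f z)" unfolding q_def by (simp add: algebra_simps)
    then have "dist v (q s1) = s1 * dist v (f z)" using s0 by (simp add: dist_norm)
    also have "\<dots> \<le> e / (2 * dist v (f z)) * dist v (f z)" unfolding s1_def by (intro mult_right_mono) auto
    also have "\<dots> < e" using fzv e(1) by simp
    finally have "q s1 \<in> ball v e" by simp
    then show "locally_glued (h s1)" using e(2) hD[OF s0] h(4)[OF s0] by simp
  qed
  then have "locally_glued (h 1)"
  proof (intro connected_induction_simple[of "{0<..1}" s1 1 "\<lambda>s. locally_glued (h s)"])
    fix s :: real assume s: "s \<in> {0<..1}"
    obtain e where e: "e > 0" "\<forall>x\<in>\<D>. f x \<in> ball (q s) e \<longrightarrow>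
        (\<exists>N c. branched_chart f (q s) e N c \<and> x \<in> N \<and>
          (\<forall>x\<in>N. \<forall>y\<in>N. v \<in> closed_segment p (f x) \<longrightarrow> locally_glued x \<longrightarrow> locally_glued y))"
      using locally_glued_propagates[OF q_reg[OF s] v(1) q_slit[OF s]] by blast
    have "f (h s) \<in> ball (q s) e" using h(4)[OF s] e(1) by simp
    then obtain N c where N: "branched_chart f (q s) e N c" "h s \<in> N"
        "\<forall>x\<in>N. \<forall>y\<in>N. v \<in> closed_segment p (f x) \<longrightarrow> locally_glued x \<longrightarrow> locally_glued y"
      using e(2) hD[OF s] by blast
    define T where "T = {0<..1} \<inter> h -` N"
    have "openin (top_of_set {0<..1}) T"
      unfolding T_def using h(1) chart_open[OF N(1)] by (rule continuous_openin_preimage_gen)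
    moreover have "s \<in> T" unfolding T_def using s N(2) by simp
    moreover have "locally_glued (h b)" if "a \<in> T" "b \<in> T" "locally_glued (h a)" for a b
    proof -
      have "h a \<in> N" "h b \<in> N" "a \<in> {0<..1}" using that unfolding T_def by auto
      then show ?thesis using N(3) q_slit h(4) that(3) by metis
    qed
    ultimately show "\<exists>T. openin (top_of_set {0<..1}) T \<and> s \<in> T \<and>
        (\<forall>x\<in>T. \<forall>y\<in>T. locally_glued (h x) \<longrightarrow> locally_glued (h y))" by blast
  qed (use s0 in auto)
  then show ?thesis using h(3) by simp
qed

lemma locally_glued_everywhere:
  assumes z: "z \<in> \<D>"
  shows "locally_glued z"
proof (cases "f z \<in> star")
  case True
  then show ?thesis using z locally_glued_over_star unfolding over_star_def by blast
next
  case False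
  have "closed_segment p (f z) \<subseteq> \<D>"
    using p_disk in_disk[OF z] by (simp add: closed_segment_subset)
  then obtain v where v: "v \<in> critical_values" "v \<in> closed_segment p (f z)"
    using False unfolding star_def regular_values_def by blast
  show ?thesis
  proof (cases "f z \<in> critical_values")
    case True
    then show ?thesis
      using locally_glued_near_critical_value[OF True] z by (metis centre_in_ball)
  next
    case False
    then show ?thesis
      using locally_glued_on_slit[OF z _ v] in_disk[OF z] unfolding regular_values_def by blast
  qed
qed

lemma over_star_dense:
  assumes "open U" "U \<subseteq> \<D>" "z \<in> U"
  shows "U \<inter> over_star \<noteq> {}"
proof (cases "f z \<in> star")
  case True
  then show ?thesis using assms unfolding over_star_def by blast
next
  case False
  have fzD: "f z \<in> \<D>" using in_disk assms by blast
  then have "closed_segment p (f z) \<subseteq> \<D>"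
    using p_disk by (simp add: closed_segment_subset)
  then obtain v where v: "v \<in> critical_values" "v \<in> closed_segment p (f z)"
    using False unfolding star_def regular_values_def by blast
  have vp: "v \<noteq> p" using p_not_critical[OF v(1)] .
  obtain d where d: "d > 0" "\<forall>x\<in>ball (f z) d. x \<in> star \<longleftrightarrow> \<not> (Im (slit v x) = 0 \<and> 1 \<le> Re (slit v x))"
    using star_near[OF fzD v] by blast
  have "open (f ` U \<inter> ball (f z) d)"
    using open_image[OF assms(1,2)] by (intro open_Int) auto
  moreover have "f z \<in> f ` U \<inter> ball (f z) d" using assms(3) d(1) by simp
  ultimately obtain \<eta> where \<eta>: "\<eta> > 0" "f z + of_real \<eta> * \<i> * (v - p) \<in> f ` U \<inter> ball (f z) d"
    using shift_in_open by blast
  have "Im (slit v (f z)) = 0"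
    using v(2) mem_segment_iff_slit_coordinate[OF vp] by simp
  then have "Im (slit v (f z + of_real \<eta> * \<i> * (v - p))) = \<eta>"
    unfolding slit_shift[OF vp] by simp
  then have "f z + of_real \<eta> * \<i> * (v - p) \<in> star" using d(2) \<eta> by (metis IntD2 less_irrefl)
  moreover obtain x where "x \<in> U" "f x = f z + of_real \<eta> * \<i> * (v - p)"
    using \<eta>(2) by (metis IntD1 image_iff)
  ultimately have "x \<in> over_star" using assms(2) unfolding over_star_def by auto
  then show ?thesis using \<open>x \<in> U\<close> by blast
qed

text \<open>By local gluing, being glued to \<open>w\<close> is an open and closed condition on the sheet labels near a
  point, so it holds on the whole unit disk.\<close>

lemma fibre_glued:
  assumes w: "w \<in> \<D>" "f w = p0" and z: "z \<in> \<D>" "f z = p0"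
  shows "glued f w z"
proof -
  define P where "P x \<longleftrightarrow> (\<exists>U. open U \<and> x \<in> U \<and> (\<forall>y\<in>U \<inter> over_star. glued f w (base y)))" for x
  note bw = base_self[OF w] and bz = base_self[OF z]
  have "P z"
  proof (rule connected_induction_simple[of \<D> w z P])
    show "P w"
      using locally_glued_everywhere[OF w(1)] bw unfolding P_def locally_glued_def
      by (metis IntI)
    fix x assume x: "x \<in> \<D>"
    then obtain U where U: "open U" "x \<in> U"
        "\<forall>a\<in>U \<inter> over_star. \<forall>b\<in>U \<inter> over_star. glued f (base a) (base b)"
      using locally_glued_everywhere unfolding locally_glued_def by blast
    show "\<exists>T. openin (top_of_set \<D>) T \<and> x \<in> T \<and> (\<forall>a\<in>T. \<forall>b\<in>T. P a \<longrightarrow> P b)"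
    proof (intro exI[of _ "\<D> \<inter> U"] conjI ballI impI)
      show "openin (top_of_set \<D>) (\<D> \<inter> U)" by (rule openin_open_Int[OF U(1)])
      show "x \<in> \<D> \<inter> U" using x U(2) by blast
      fix a b assume ab: "a \<in> \<D> \<inter> U" "b \<in> \<D> \<inter> U" and "P a"
      obtain W where W: "open W" "a \<in> W" "\<forall>y\<in>W \<inter> over_star. glued f w (base y)"
        using \<open>P a\<close> unfolding P_def by blast
      have "(W \<inter> U \<inter> \<D>) \<inter> over_star \<noteq> {}"
        by (rule over_star_dense[of _ a]) (use W(1,2) U(1) ab in auto)
      then obtain y where y: "y \<in> W \<inter> over_star" "y \<in> U \<inter> over_star" by blast
      then have "\<forall>x\<in>U \<inter> over_star. glued f w (base x)"
        using W(3) U(3) glued_trans by blast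
      then show "P b" unfolding P_def using U(1) ab(2) by blast
    qed
  qed (use w(1) z(1) in simp_all)
  then obtain U where "z \<in> U" "\<forall>y\<in>U \<inter> over_star. glued f w (base y)"
    unfolding P_def by blast
  then show ?thesis using bz by (metis IntI)
qed

end

context branched_disk_covering
begin

text \<open>The forbidden centres lie on the countably many lines through two critical values, which form a
  null set.\<close>

lemma generic_centre:
  assumes p0: "p0 \<in> regular_values"
  shows "\<exists>p. slit_disk f p p0"
proof -
  obtain d where d: "d > 0" "ball p0 d \<subseteq> regular_values"
    using p0 open_regular_values by (metis openE)
  \<comment> \<open>Multiplication by \<i> turns the direction of the line into a normal vector.\<close>
  define line where "line u v = {x. (\<i> * (v - u)) \<bullet> x = (\<i> * (v - u)) \<bullet> u}" for u v :: complex
  define L where "L = (\<Union>(u, v)\<in>{(u, v) \<in> critical_values \<times> critical_values. u \<noteq> v}. line u v)"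
  have "negligible L"
    unfolding L_def
  proof (rule negligible_countable_Union)
    show "countable ((\<lambda>(u, v). line u v) ` {(u, v) \<in> critical_values \<times> critical_values. u \<noteq> v})"
      by (intro countable_image countable_subset[OF _ countable_SIGMA[OF countable_critical_values countable_critical_values]]) auto
    fix S assume "S \<in> (\<lambda>(u, v). line u v) ` {(u, v) \<in> critical_values \<times> critical_values. u \<noteq> v}"
    then show "negligible S" by (auto simp: line_def intro!: negligible_hyperplane)
  qed
  then have "\<not> ball p0 d \<subseteq> L"
    using d(1) open_not_negligible[of "ball p0 d"] negligible_subset by auto
  then obtain p where p: "p \<in> ball p0 d" "p \<notin> L" by blast
  have "slit_disk f p p0"
  proof (intro slit_disk.intro slit_disk_axioms.intro branched_disk_covering_axioms)
    show "closed_segment p p0 \<subseteq> regular_values"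
      using closed_segment_subset[OF p(1) _ convex_ball, of p0] d by (meson centre_in_ball order_trans)
    fix u v q assume uv: "u \<in> critical_values" "v \<in> critical_values"
      "u \<in> closed_segment p q" "v \<in> closed_segment p q"
    obtain s where s: "u = (1 - s) *\<^sub>R p + s *\<^sub>R q" using uv(3) by (auto simp: in_segment)
    obtain t where t: "v = (1 - t) *\<^sub>R p + t *\<^sub>R q" using uv(4) by (auto simp: in_segment)
    have "p - u = (- s) *\<^sub>R (q - p)" "v - u = (t - s) *\<^sub>R (q - p)"
      unfolding s t by (simp_all add: algebra_simps)
    then have "(\<i> * (v - u)) \<bullet> (p - u) = 0"
      by (simp add: inner_complex_def) (simp add: algebra_simps)
    then have "p \<in> line u v" unfolding line_def by (simp add: inner_diff_right)
    then show "u = v" using p(2) uv unfolding L_def by blast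
  qed
  then show ?thesis by blast
qed

theorem gluable: "gluable f"
proof -
  have "gluable_wrt f w" if w: "w \<in> regular_part f" for w
  proof -
    have "w \<in> \<D>" "f w \<in> regular_values" using w unfolding regular_part_eq by auto
    then obtain p where "slit_disk f p (f w)" using generic_centre by blast
    then show ?thesis
      unfolding gluable_wrt_def using slit_disk.fibre_glued \<open>w \<in> \<D>\<close> by blast
  qed
  then show ?thesis
    unfolding gluable_def using hol closedin_critical_fibres connected_regular_part by blast
qed

end

section \<open>Bounded holomorphic functions on the disk\<close>

text \<open>The automorphism of the unit disk that exchanges \<open>a\<close> and 0; it is its own inverse, which saves
  handling inverses separately.\<close>

definition disk_involution :: "complex \<Rightarrow> complex \<Rightarrow> complex"
  where "disk_involution a w = (a - w) / (1 - cnj a * w)"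

lemma denominator_nonzero:
  assumes "cmod a < 1" "cmod w \<le> 1"
  shows "1 - cnj a * w \<noteq> 0"
proof
  assume "1 - cnj a * w = 0"
  then have "cmod (cnj a * w) = 1" by (metis eq_iff_diff_eq_0 norm_one)
  then have "cmod a * cmod w = 1" by (simp add: norm_mult)
  moreover have "cmod a * cmod w \<le> cmod a" using assms(2) by (simp add: mult_left_le)
  ultimately show False using assms(1) by simp
qed

lemma disk_involution_eq_Moebius: "disk_involution a w = - Moebius_function 0 a w"
  unfolding disk_involution_def Moebius_function_simple by (metis minus_diff_eq minus_divide_left)

lemma disk_involution_in_disk: "a \<in> \<D> \<Longrightarrow> w \<in> \<D> \<Longrightarrow> disk_involution a w \<in> \<D>"
  unfolding disk_involution_eq_Moebius using Moebius_function_norm_lt_1[of a w 0] by simp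

lemma holomorphic_disk_involution: "a \<in> \<D> \<Longrightarrow> disk_involution a holomorphic_on \<D>"
  using Moebius_function_holomorphic[of a 0] unfolding disk_involution_eq_Moebius[abs_def]
  by (auto intro: holomorphic_on_minus)

lemma continuous_disk_involution: "a \<in> \<D> \<Longrightarrow> continuous_on (cball 0 1) (disk_involution a)"
  unfolding disk_involution_def
  using denominator_nonzero[of a] by (intro continuous_intros) auto

lemma disk_involution_involution:
  assumes "a \<in> \<D>" "w \<in> \<D>"
  shows "disk_involution a (disk_involution a w) = w"
proof -
  define d where "d = 1 - cnj a * w"
  have d: "d \<noteq> 0" unfolding d_def using denominator_nonzero[of a w] assms by simp
  have e: "1 - cnj a * a \<noteq> 0" using denominator_nonzero[of a a] assms by simp
  have num: "a - (a - w) / d = w * (1 - cnj a * a) / d"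
    using d unfolding d_def by (simp add: field_simps)
  have den: "1 - cnj a * ((a - w) / d) = (1 - cnj a * a) / d"
    using d unfolding d_def by (simp add: field_simps)
  show ?thesis
    unfolding disk_involution_def d_def[symmetric] num den using d e by simp
qed

lemma norm_disk_involution_boundary:
  assumes "a \<in> \<D>" "cmod w = 1"
  shows "cmod (disk_involution a w) = 1"
proof -
  have "cmod (1 - cnj a * w) = cmod (a - w)"
  proof -
    have "w * cnj w = 1" using assms(2) complex_norm_square[of w] by simp
    then have "1 - cnj a * w = w * cnj (w - a)" by (simp add: algebra_simps)
    then have "cmod (1 - cnj a * w) = cmod w * cmod (w - a)"
      by (metis complex_mod_cnj norm_mult)
    then show ?thesis using assms(2) by (simp add: norm_minus_commute)
  qed
  moreover have "a \<noteq> w" using assms by auto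
  ultimately show ?thesis
    unfolding disk_involution_def by (simp add: norm_divide)
qed

lemma norm_disk_involution_commute: "cmod (disk_involution a w) = cmod (disk_involution w a)"
proof -
  have "cnj (1 - cnj a * w) = 1 - cnj w * a" by simp
  then have "cmod (1 - cnj a * w) = cmod (1 - cnj w * a)" by (metis complex_mod_cnj)
  then show ?thesis
    unfolding disk_involution_def by (simp add: norm_divide norm_minus_commute)
qed

lemma pseudohyp_dist_eq: "pseudohyp_dist z l = cmod (disk_involution l z)"
  unfolding pseudohyp_dist_def disk_involution_def ..

text \<open>Schwarz--Pick\<close>

text \<open>A form of Schwarz--Pick: a function bounded by 1 whose value at 0 is close to the unit circle
  is nearly constant on every smaller disk.\<close>

lemma oscillation_bound:
  assumes hol: "g holomorphic_on \<D>" and le1: "\<And>z. z \<in> \<D> \<Longrightarrow> cmod (g z) \<le> 1"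
    and R: "cmod \<zeta> \<le> R" "R < 1"
  shows "cmod (g \<zeta> - g 0) \<le> (1 - (cmod (g 0))\<^sup>2) * R / (1 - R)"
proof -
  have R0: "0 \<le> R" using R(1) norm_ge_zero[of \<zeta>] by linarith
  have \<zeta>D: "\<zeta> \<in> \<D>" using R by simp
  \<comment> \<open>The factor s makes the function strictly less than 1, as the Schwarz lemma requires; s tends to 1 at the end.\<close>
  have bound: "s * cmod (g 0 - g \<zeta>) * (1 - R) \<le> (1 - s\<^sup>2 * (cmod (g 0))\<^sup>2) * R"
    if s: "0 < s" "s < 1" for s :: real
  proof -
    define a where "a = of_real s * g 0"
    define b where "b = of_real s * g \<zeta>"
    have lt1: "of_real s * g z \<in> \<D>" if "z \<in> \<D>" for z
    proof -
      have "s * cmod (g z) \<le> s * 1" using s le1[OF that] by (intro mult_left_mono) auto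
      then have "s * cmod (g z) < 1" using s by linarith
      then show ?thesis using s by (simp add: norm_mult)
    qed
    have aD: "a \<in> \<D>" unfolding a_def by (rule lt1) simp
    define G where "G z = disk_involution a (of_real s * g z)" for z
    have "G holomorphic_on \<D>"
      unfolding G_def
      by (rule holomorphic_on_compose_gen[unfolded o_def, OF _ holomorphic_disk_involution[OF aD]])
         (use lt1 hol in \<open>auto intro!: holomorphic_intros\<close>)
    moreover have "G 0 = 0" unfolding G_def a_def disk_involution_def by simp
    moreover have "cmod (G z) < 1" if "cmod z < 1" for z
      using disk_involution_in_disk[OF aD lt1, of z] that unfolding G_def by simp
    ultimately have "cmod (G \<zeta>) \<le> cmod \<zeta>" using Schwarz_Lemma(1)[of G \<zeta>] \<zeta>D by simp
    then have "cmod (a - b) / cmod (1 - cnj a * b) \<le> R"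
      using R(1) unfolding G_def disk_involution_def b_def by (simp add: norm_divide)
    moreover have "0 < cmod (1 - cnj a * b)"
      using denominator_nonzero[of a b] aD lt1[OF \<zeta>D] unfolding b_def by simp
    ultimately have "cmod (a - b) \<le> R * cmod (1 - cnj a * b)" by (simp add: divide_le_eq)
    \<comment> \<open>Expressing the denominator through a - b turns the estimate into a linear inequality for |a - b|.\<close>
    also have "1 - cnj a * b = of_real (1 - (cmod a)\<^sup>2) + cnj a * (a - b)"
      using complex_norm_square[of a] by (simp add: algebra_simps)
    also have "cmod (of_real (1 - (cmod a)\<^sup>2) + cnj a * (a - b)) \<le> (1 - (cmod a)\<^sup>2) + cmod (a - b)"
    proof -
      have a1: "cmod a \<le> 1" using aD by simp
      then have "(cmod a)\<^sup>2 \<le> 1" by (simp add: power_le_one)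
      then have "cmod (of_real (1 - (cmod a)\<^sup>2)) = 1 - (cmod a)\<^sup>2" by (metis abs_of_nonneg diff_ge_0_iff_ge norm_of_real)
      moreover have "cmod (cnj a * (a - b)) \<le> cmod (a - b)"
        using a1 by (simp add: norm_mult mult_left_le_one_le)
      ultimately show ?thesis
        using norm_triangle_ineq[of "of_real (1 - (cmod a)\<^sup>2)" "cnj a * (a - b)"] by linarith
    qed
    finally have "cmod (a - b) \<le> R * ((1 - (cmod a)\<^sup>2) + cmod (a - b))"
      using R0 by (simp add: mult_left_mono)
    then have "cmod (a - b) * (1 - R) \<le> (1 - (cmod a)\<^sup>2) * R" by (simp add: algebra_simps)
    moreover have "cmod (a - b) = s * cmod (g 0 - g \<zeta>)"
      unfolding a_def b_def right_diff_distrib[symmetric] using s by (simp add: norm_mult)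
    moreover have "(cmod a)\<^sup>2 = s\<^sup>2 * (cmod (g 0))\<^sup>2"
      unfolding a_def by (simp add: norm_mult power_mult_distrib)
    ultimately show ?thesis by simp
  qed
  have "1 * cmod (g 0 - g \<zeta>) * (1 - R) \<le> (1 - 1\<^sup>2 * (cmod (g 0))\<^sup>2) * R"
  proof (rule tendsto_le[of "at_left (1::real)"])
    show "((\<lambda>s. (1 - s\<^sup>2 * (cmod (g 0))\<^sup>2) * R) \<longlongrightarrow> (1 - 1\<^sup>2 * (cmod (g 0))\<^sup>2) * R) (at_left 1)"
      by (intro tendsto_intros)
    show "((\<lambda>s. s * cmod (g 0 - g \<zeta>) * (1 - R)) \<longlongrightarrow> 1 * cmod (g 0 - g \<zeta>) * (1 - R)) (at_left 1)"
      by (intro tendsto_intros)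
    show "eventually (\<lambda>s. s * cmod (g 0 - g \<zeta>) * (1 - R) \<le> (1 - s\<^sup>2 * (cmod (g 0))\<^sup>2) * R) (at_left 1)"
      using eventually_at_left_real[OF zero_less_one] by eventually_elim (use bound in auto)
  qed simp
  then show ?thesis
    using R(2) by (simp add: pos_le_divide_eq norm_minus_commute)
qed

text \<open>The map is \<open>h(0) \<zeta>\<close> plus the error \<open>\<zeta> (h(\<zeta>) - h(0))\<close>. If \<open>|h(0)|\<close> is close to 1, the error is a
  Lipschitz function with constant below \<open>|h(0)|\<close>, by the oscillation bound and the Cauchy estimate, so
  it cannot undo the separation of points by the linear part.\<close>

lemma injective_of_large_derivative:
  assumes hol: "h holomorphic_on \<D>" and le1: "\<And>z. z \<in> \<D> \<Longrightarrow> cmod (h z) \<le> 1"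
    and R: "0 < R" "R < 1" and large: "4 * (1 - (cmod (h 0))\<^sup>2) / (1 - R)\<^sup>2 < cmod (h 0)"
  shows "inj_on (\<lambda>\<zeta>. \<zeta> * h \<zeta>) (ball 0 R)"
proof -
  \<comment> \<open>The radius for the Cauchy estimate: halfway from the disk of radius R to the unit circle.\<close>
  define \<rho> where "\<rho> = (1 - R) / 2"
  define K where "K = (1 - (cmod (h 0))\<^sup>2) / \<rho>"
  define \<phi> where "\<phi> \<zeta> = \<zeta> * (h \<zeta> - h 0)" for \<zeta>
  have \<rho>: "0 < \<rho>" "\<rho> < 1" "R + \<rho> = 1 - \<rho>" unfolding \<rho>_def using R by (auto simp: field_simps)
  have nn: "0 \<le> 1 - (cmod (h 0))\<^sup>2" using le1[of 0] by (simp add: power_le_one)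
  have K: "K / \<rho> < cmod (h 0)"
    using large \<rho>(1) unfolding K_def \<rho>_def by (simp add: power2_eq_square field_simps)
  have hol\<phi>: "\<phi> holomorphic_on \<D>" unfolding \<phi>_def by (intro holomorphic_intros hol)
  have \<phi>K: "cmod (\<phi> x) \<le> K" if x: "cmod x \<le> R + \<rho>" for x
  proof -
    have "cmod (h x - h 0) \<le> (1 - (cmod (h 0))\<^sup>2) * (R + \<rho>) / (1 - (R + \<rho>))"
      by (rule oscillation_bound[OF hol le1 x]) (use \<rho> in auto)
    also have "\<dots> \<le> K"
      unfolding K_def \<rho>(3) using \<rho>(1,2) nn by (simp add: divide_right_mono mult_left_le)
    finally have "cmod (h x - h 0) \<le> K" .
    moreover have "cmod x \<le> 1" using x \<rho> by simp
    ultimately show ?thesis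
      unfolding \<phi>_def norm_mult by (meson mult_left_le_one_le norm_ge_zero order_trans)
  qed
  have d\<phi>: "cmod (deriv \<phi> \<zeta>) \<le> K / \<rho>" if \<zeta>: "\<zeta> \<in> ball 0 R" for \<zeta>
  proof -
    have sub: "cball \<zeta> \<rho> \<subseteq> \<D>"
    proof
      fix x assume "x \<in> cball \<zeta> \<rho>"
      then have "cmod x \<le> cmod \<zeta> + \<rho>" using norm_triangle_ineq2[of x \<zeta>] by (simp add: dist_norm norm_minus_commute)
      then show "x \<in> \<D>" using \<zeta> \<rho> by simp
    qed
    have "cmod ((deriv ^^ 1) \<phi> \<zeta>) \<le> fact 1 * K / \<rho> ^ 1"
    proof (rule Cauchy_inequality)
      show "\<phi> holomorphic_on ball \<zeta> \<rho>"
        using hol\<phi> sub ball_subset_cball by (meson holomorphic_on_subset order_trans)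
      show "continuous_on (cball \<zeta> \<rho>) \<phi>"
        using hol\<phi> sub by (meson continuous_on_subset holomorphic_on_imp_continuous_on)
      fix x assume "cmod (\<zeta> - x) = \<rho>"
      then have "cmod x \<le> R + \<rho>"
        using norm_triangle_ineq2[of x \<zeta>] \<zeta> by (simp add: norm_minus_commute)
      then show "cmod (\<phi> x) \<le> K" by (rule \<phi>K)
    qed (rule \<rho>)
    then show ?thesis by simp
  qed
  show ?thesis
  proof (rule inj_onI)
    fix x y assume xy: "x \<in> ball 0 R" "y \<in> ball 0 R" and eq: "x * h x = y * h y"
    have "cmod (\<phi> x - \<phi> y) \<le> K / \<rho> * cmod (x - y)"
    proof (rule field_differentiable_bound[OF convex_ball])
      fix z assume z: "z \<in> ball (0::complex) R"
      then have "z \<in> \<D>" using R(2) by simp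
      then show "(\<phi> has_field_derivative deriv \<phi> z) (at z within ball 0 R)"
        using holomorphic_derivI[OF hol\<phi> open_ball] by blast
    qed (use d\<phi> xy in auto)
    moreover have "\<phi> x - \<phi> y = - (h 0 * (x - y))"
      unfolding \<phi>_def using eq by (simp add: algebra_simps)
    ultimately have le: "cmod (h 0) * cmod (x - y) \<le> K / \<rho> * cmod (x - y)"
      by (simp add: norm_mult)
    show "x = y"
    proof (rule ccontr)
      assume "x \<noteq> y"
      then have "cmod (h 0) \<le> K / \<rho>" using le by (intro mult_right_le_imp_le[OF le]) simp
      then show False using K by simp
    qed
  qed
qed

text \<open>Relative closedness in the preimage and injectivity make the sheet a connected component of the
  sublevel set \<open>{|f| < r}\<close>.\<close>

definition sheet_over_disk :: "(complex \<Rightarrow> complex) \<Rightarrow> real \<Rightarrow> complex set \<Rightarrow> bool"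
  where "sheet_over_disk f r U \<longleftrightarrow> open U \<and> closure U \<subseteq> \<D> \<and> inj_on f U \<and> f ` U = ball 0 r \<and>
    (\<forall>x\<in>closure U. f x \<in> ball 0 r \<longrightarrow> x \<in> U)"

text \<open>On the bounding circle \<open>|f| > r\<close>, so the sublevel set inside the pseudohyperbolic disk is cut off
  from the rest. Its image is open, and closed in the disk of radius \<open>r\<close>, hence all of that disk.\<close>

lemma sheet_in_pseudohyp_disk:
  assumes hol: "f holomorphic_on \<D>" and a: "a \<in> \<D>" "f a = 0" and r: "0 < r" and R: "0 < R" "R < 1"
    and inj: "inj_on f {z \<in> \<D>. cmod (disk_involution a z) < R}"
    and large: "\<And>z. z \<in> \<D> \<Longrightarrow> cmod (disk_involution a z) = R \<Longrightarrow> r < cmod (f z)"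
  shows "sheet_over_disk f r {z \<in> \<D>. cmod (disk_involution a z) < R \<and> cmod (f z) < r}"
    (is "sheet_over_disk f r ?U")
proof -
  note contf = holomorphic_on_imp_continuous_on[OF hol]
  note contd = holomorphic_on_imp_continuous_on[OF holomorphic_disk_involution[OF a(1)]]
  have U_eq: "?U = (\<D> \<inter> disk_involution a -` ball 0 R) \<inter> (\<D> \<inter> f -` ball 0 r)" by auto
  have opU: "open ?U"
    unfolding U_eq by (intro open_Int continuous_open_preimage contf contd open_ball)
  define K where "K = cball 0 1 \<inter> disk_involution a -` cball 0 R"
  have "closed K"
    unfolding K_def using continuous_disk_involution[OF a(1)]
    by (intro continuous_closed_preimage closed_cball)
  moreover have "bounded K" unfolding K_def by (rule bounded_subset[OF bounded_cball]) auto
  ultimately have compK: "compact K" by (simp add: compact_eq_bounded_closed)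
  have KD: "K \<subseteq> \<D>"
  proof
    fix x assume x: "x \<in> K"
    then have "cmod x \<noteq> 1" using norm_disk_involution_boundary[OF a(1), of x] R(2) unfolding K_def by auto
    then show "x \<in> \<D>" using x unfolding K_def by auto
  qed
  have UK: "?U \<subseteq> K" unfolding K_def by auto
  have KU: "x \<in> ?U" if "x \<in> K" "f x \<in> ball 0 r" for x
  proof -
    have xD: "x \<in> \<D>" using KD that(1) by (rule subsetD)
    then have "cmod (disk_involution a x) \<noteq> R" using large[of x] that(2) by auto
    then show ?thesis using xD that unfolding K_def by auto
  qed
  have clU: "closure ?U \<subseteq> K"
    using UK \<open>closed K\<close> by (rule closure_minimal)
  have injU: "inj_on f ?U" by (rule inj_on_subset[OF inj]) auto
  have onto: "f ` ?U = ball 0 r"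
  proof -
    have sub: "f ` ?U \<subseteq> ball 0 r" by auto
    have "open (f ` ?U)"
      by (rule open_mapping_thm3[OF holomorphic_on_subset[OF hol] opU injU]) auto
    then have op: "openin (top_of_set (ball 0 r)) (f ` ?U)"
      using sub by (simp add: open_openin_trans)
    have "f ` ?U = ball 0 r \<inter> f ` K"
      using UK KU sub by blast
    moreover have "closed (f ` K)"
      using compact_continuous_image[OF continuous_on_subset[OF contf KD] compK]
      by (rule compact_imp_closed)
    ultimately have "closedin (top_of_set (ball 0 r)) (f ` ?U)"
      by (simp add: closedin_closed_Int)
    moreover have "0 \<in> f ` ?U"
      using a r R by (intro image_eqI[of _ _ a]) (auto simp: disk_involution_def)
    ultimately show ?thesis
      using op connected_ball[of "0::complex" r] unfolding connected_clopen by blast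
  qed
  show ?thesis
    unfolding sheet_over_disk_def using opU clU KD injU onto KU by blast
qed

text \<open>Off the pseudohyperbolic disks around the zeros the finite product has no zeros, so its modulus
  attains its minimum on the boundary: on one of the circles, or on the unit circle, where the
  modulus is 1.\<close>

lemma finite_product_minimum:
  fixes z :: "'i \<Rightarrow> complex"
  assumes J: "finite J" "\<And>j. j \<in> J \<Longrightarrow> z j \<in> \<D>" and R: "0 < R" and \<rho>: "0 < \<rho>" "\<rho> \<le> 1"
    and circles: "\<And>k x. k \<in> J \<Longrightarrow> x \<in> \<D> \<Longrightarrow> cmod (disk_involution (z k) x) = R \<Longrightarrow>
      \<rho> \<le> (\<Prod>j\<in>J. cmod (disk_involution (z j) x))"
    and w: "w \<in> \<D>" "\<And>k. k \<in> J \<Longrightarrow> R \<le> cmod (disk_involution (z k) w)"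
  shows "\<rho> \<le> (\<Prod>j\<in>J. cmod (disk_involution (z j) w))"
proof -
  define X where "X = cball 0 1 \<inter> (\<Inter>k\<in>J. cball 0 1 \<inter> disk_involution (z k) -` (- ball 0 R))"
  define F where "F x = (\<Prod>j\<in>J. disk_involution (z j) x)" for x
  have normF: "cmod (F x) = (\<Prod>j\<in>J. cmod (disk_involution (z j) x))" for x
    unfolding F_def by (rule prod_norm[symmetric])
  have memX: "x \<in> X \<longleftrightarrow> cmod x \<le> 1 \<and> (\<forall>k\<in>J. R \<le> cmod (disk_involution (z k) x))" for x
    unfolding X_def by auto
  have "closed X"
    unfolding X_def using J(2)
    by (intro closed_Int closed_INT ballI continuous_closed_preimage continuous_disk_involution
        closed_cball closed_Compl open_ball) auto
  have F0: "F x \<noteq> 0" if "x \<in> X" for x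
  proof -
    have "disk_involution (z j) x \<noteq> 0" if "j \<in> J" for j
      using \<open>x \<in> X\<close> that R unfolding memX by force
    then show ?thesis unfolding F_def using J(1) by simp
  qed
  have XD: "interior X \<subseteq> \<D>"
    using interior_mono[of X "cball 0 1"] memX by (auto simp: subset_eq)
  have contF: "continuous_on X F"
    unfolding F_def using J(2)
    by (intro continuous_on_prod continuous_on_subset[OF continuous_disk_involution]) (auto simp: memX)
  have holF: "F holomorphic_on interior X"
    unfolding F_def using J(2) XD
    by (intro holomorphic_on_prod holomorphic_on_subset[OF holomorphic_disk_involution]) auto
  have "cmod (1 / F w) \<le> 1 / \<rho>"
  proof (rule maximum_modulus_frontier[where f = "\<lambda>x. 1 / F x" and S = X])
    show "(\<lambda>x. 1 / F x) holomorphic_on interior X"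
      using F0 interior_subset by (intro holomorphic_on_divide holomorphic_on_const holF) blast
    show "continuous_on (closure X) (\<lambda>x. 1 / F x)"
      unfolding closure_closed[OF \<open>closed X\<close>]
      using F0 by (intro continuous_on_divide continuous_on_const contF) blast
    show "bounded X" by (rule bounded_subset[OF bounded_cball[of 0 1]]) (auto simp: memX)
    show "w \<in> X" using w unfolding memX by auto
    fix x assume "x \<in> frontier X"
    then have x: "x \<in> X" "x \<notin> interior X"
      unfolding frontier_def closure_closed[OF \<open>closed X\<close>] by auto
    have "\<rho> \<le> cmod (F x)"
    proof (cases "cmod x = 1")
      case True
      then have "cmod (F x) = 1"
        unfolding normF using norm_disk_involution_boundary J(2) by simp
      then show ?thesis using \<rho> by simp
    next
      case False
      then have xD: "x \<in> \<D>" using x(1) memX by auto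
      have "\<exists>k\<in>J. cmod (disk_involution (z k) x) = R"
      proof (rule ccontr)
        assume "\<not> (\<exists>k\<in>J. cmod (disk_involution (z k) x) = R)"
        then have gt: "\<forall>k\<in>J. R < cmod (disk_involution (z k) x)"
          using x(1) memX by (auto simp: less_le)
        define W where "W = \<D> \<inter> (\<Inter>k\<in>J. \<D> \<inter> disk_involution (z k) -` (- cball 0 R))"
        have "open W"
          unfolding W_def using J
          by (intro open_Int open_INT ballI continuous_open_preimage open_ball open_Compl closed_cball
              holomorphic_on_imp_continuous_on holomorphic_disk_involution) auto
        moreover have "W \<subseteq> X"
        proof
          fix y assume y: "y \<in> W"
          have "R \<le> cmod (disk_involution (z k) y)" if "k \<in> J" for k
          proof -
            have "y \<in> disk_involution (z k) -` (- cball 0 R)" using y that unfolding W_def by blast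
            then show ?thesis by simp
          qed
          then show "y \<in> X" using y unfolding W_def memX by auto
        qed
        moreover have "x \<in> W" using xD gt unfolding W_def by auto
        ultimately show False using x(2) interiorI by blast
      qed
      then show ?thesis using circles[OF _ xD] unfolding normF by blast
    qed
    then show "cmod (1 / F x) \<le> 1 / \<rho>"
      using \<rho>(1) by (simp add: norm_divide frac_le)
  qed
  then have "\<rho> \<le> cmod (F w)"
    using \<rho>(1) F0[of w] w by (simp add: norm_divide memX divide_simps split: if_splits)
  then show ?thesis unfolding normF .
qed

section \<open>Blaschke products\<close>

text \<open>Locally uniform convergence of an infinite product by the Weierstrass M-test.\<close>

lemma holomorphic_prodinf:
  fixes F :: "nat \<Rightarrow> complex \<Rightarrow> complex"
  assumes "open S" and hol: "\<And>n. F n holomorphic_on S"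
    and bound: "\<And>K. compact K \<Longrightarrow> K \<subseteq> S \<Longrightarrow>
      \<exists>M. summable M \<and> (\<forall>n. \<forall>x\<in>K. cmod (F n x - 1) \<le> M n)"
  shows "(\<lambda>x. \<Prod>n. F n x) holomorphic_on S"
    and "x \<in> S \<Longrightarrow> convergent_prod (\<lambda>n. F n x)"
proof -
  show conv: "convergent_prod (\<lambda>n. F n x)" if xS: "x \<in> S" for x
  proof -
    obtain M where "summable M" "\<forall>n. cmod (F n x - 1) \<le> M n"
      using bound[of "{x}"] xS by auto
    then have "summable (\<lambda>n. cmod (F n x - 1))"
      by (intro summable_comparison_test[of "\<lambda>n. cmod (F n x - 1)" M]) auto
    then show ?thesis
      by (intro abs_convergent_prod_imp_convergent_prod summable_imp_abs_convergent_prod)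
  qed
  show "(\<lambda>x. \<Prod>n. F n x) holomorphic_on S"
  proof (rule holomorphic_uniform_sequence[OF \<open>open S\<close>])
    show "(\<lambda>x. \<Prod>n<N. F n x) holomorphic_on S" for N
      by (intro holomorphic_on_prod hol)
    fix x assume "x \<in> S"
    then obtain d where d: "d > 0" "cball x d \<subseteq> S"
      using \<open>open S\<close> open_contains_cball by blast
    obtain M where M: "summable M" "\<forall>n. \<forall>y\<in>cball x d. cmod (F n y - 1) \<le> M n"
      using bound[OF compact_cball d(2)] by blast
    have "uniformly_convergent_on (cball x d) (\<lambda>N y. \<Sum>n<N. cmod (F n y - 1))"
      by (rule Weierstrass_m_test'[OF _ M(1)]) (use M(2) in auto)
    then have "uniformly_convergent_on (cball x d) (\<lambda>N y. \<Prod>n<N. F n y)"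
      using hol d(2)
      by (intro uniformly_convergent_on_prod' compact_cball)
         (meson continuous_on_subset holomorphic_on_imp_continuous_on)
    then obtain l where l: "uniform_limit (cball x d) (\<lambda>N y. \<Prod>n<N. F n y) l sequentially"
      unfolding uniformly_convergent_on_def by blast
    have "l y = (\<Prod>n. F n y)" if "y \<in> cball x d" for y
    proof -
      have "(\<lambda>N. \<Prod>n<N. F n y) \<longlonglongrightarrow> l y" using tendsto_uniform_limitI[OF l that] .
      moreover have "(\<lambda>N. \<Prod>n<N. F n y) \<longlonglongrightarrow> (\<Prod>n. F n y)"
        using convergent_prod_LIMSEQ[OF conv] that d(2) LIMSEQ_lessThan_iff_atMost by blast
      ultimately show ?thesis by (rule LIMSEQ_unique)
    qed
    then have "uniform_limit (cball x d) (\<lambda>N y. \<Prod>n<N. F n y) (\<lambda>y. \<Prod>n. F n y) sequentially"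
      by (intro iffD1[OF uniform_limit_cong' l]) auto
    then show "\<exists>d>0. cball x d \<subseteq> S \<and>
        uniform_limit (cball x d) (\<lambda>N y. \<Prod>n<N. F n y) (\<lambda>y. \<Prod>n. F n y) sequentially"
      using d by blast
  qed
qed

lemma blaschke_factor_eq:
  "a \<noteq> 0 \<Longrightarrow> blaschke_factor a w = of_real (cmod a) / a * disk_involution a w"
  "blaschke_factor 0 w = - disk_involution 0 w"
  by (auto simp: blaschke_factor_def disk_involution_def)

lemma norm_blaschke_factor: "cmod (blaschke_factor a w) = cmod (disk_involution a w)"
  by (cases "a = 0") (simp_all add: blaschke_factor_eq norm_mult norm_divide)

lemma blaschke_factor_rotation:
  assumes "a \<in> \<D>"
  shows "\<exists>u. cmod u = 1 \<and> (\<forall>\<zeta>\<in>\<D>. blaschke_factor a (disk_involution a \<zeta>) = u * \<zeta>)"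
proof (cases "a = 0")
  case True
  then show ?thesis
    using disk_involution_involution[OF assms] blaschke_factor_eq(2)
    by (intro exI[of _ "- 1"]) auto
next
  case False
  then show ?thesis
    using disk_involution_involution[OF assms] blaschke_factor_eq(1)
    by (intro exI[of _ "of_real (cmod a) / a"]) (auto simp: norm_divide)
qed

lemma holomorphic_blaschke_factor:
  assumes "a \<in> \<D>"
  shows "blaschke_factor a holomorphic_on \<D>"
proof (cases "a = 0")
  case True
  then show ?thesis
    using holomorphic_disk_involution[OF assms] unfolding True blaschke_factor_eq(2)[abs_def]
    by (intro holomorphic_on_minus)
next
  case False
  then show ?thesis
    using holomorphic_disk_involution[OF assms] unfolding blaschke_factor_eq(1)[OF False, abs_def]
    by (intro holomorphic_on_mult holomorphic_on_const)
qed

lemma blaschke_factor_near_one: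
  assumes a: "a \<in> \<D>" and w: "cmod w \<le> \<rho>" "\<rho> < 1"
  shows "cmod (blaschke_factor a w - 1) \<le> 2 / (1 - \<rho>) * (1 - cmod a)"
proof (cases "a = 0")
  case True
  have "cmod (w - 1) \<le> cmod w + 1" using norm_triangle_ineq4[of w 1] by simp
  also have "\<dots> \<le> 2" using w by simp
  also have "2 \<le> 2 / (1 - \<rho>)"
    using w order_trans[OF norm_ge_zero w(1)] by (simp add: le_divide_eq)
  finally show ?thesis using True by (simp add: blaschke_factor_def)
next
  case False
  have d: "1 - cnj a * w \<noteq> 0" using denominator_nonzero[of a w] a w by simp
  have aa: "cnj a * a = of_real (cmod a) * of_real (cmod a)"
    using complex_norm_square[of a] by (simp add: power2_eq_square mult.commute)
  have "1 - blaschke_factor a w = (a * (1 - cnj a * w) - of_real (cmod a) * (a - w)) / (a * (1 - cnj a * w))"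
    using False d by (simp add: blaschke_factor_def divide_simps)
  also have "a * (1 - cnj a * w) - of_real (cmod a) * (a - w) =
      of_real (1 - cmod a) * (a + of_real (cmod a) * w)"
  proof -
    have "a * (1 - cnj a * w) = a - cnj a * a * w" by (simp add: algebra_simps)
    then show ?thesis unfolding aa by (simp add: algebra_simps)
  qed
  finally have "cmod (1 - blaschke_factor a w) =
      cmod (of_real (1 - cmod a)) * cmod (a + of_real (cmod a) * w) / (cmod a * cmod (1 - cnj a * w))"
    by (simp only: norm_divide norm_mult)
  also have "cmod (of_real (1 - cmod a)) = 1 - cmod a"
    using a by (simp only: norm_of_real) simp
  finally have eq: "cmod (1 - blaschke_factor a w) =
      (1 - cmod a) * cmod (a + of_real (cmod a) * w) / (cmod a * cmod (1 - cnj a * w))" .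
  have "cmod (a + of_real (cmod a) * w) \<le> cmod a + cmod a * cmod w"
    using norm_triangle_ineq[of a "of_real (cmod a) * w"] by (simp add: norm_mult)
  also have "\<dots> \<le> cmod a * 2"
    using w mult_left_mono[of "cmod w" 1 "cmod a"] by simp
  finally have num: "cmod (a + of_real (cmod a) * w) \<le> cmod a * 2" .
  have "0 \<le> \<rho>" using w(1) norm_ge_zero order_trans by blast
  then have "cmod (cnj a * w) \<le> \<rho>"
    using a w by (simp add: norm_mult) (meson less_imp_le mult_left_le_one_le norm_ge_zero order_trans)
  then have den: "1 - \<rho> \<le> cmod (1 - cnj a * w)"
    using norm_triangle_ineq2[of 1 "cnj a * w"] by simp
  have "cmod (1 - blaschke_factor a w) \<le> (1 - cmod a) * (cmod a * 2) / (cmod a * (1 - \<rho>))"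
    unfolding eq using a w num den False
    by (intro frac_le mult_left_mono mult_pos_pos) auto
  also have "\<dots> = 2 / (1 - \<rho>) * (1 - cmod a)" using False by simp
  finally show ?thesis by (simp add: norm_minus_commute)
qed

locale blaschke_sequence =
  fixes z :: "nat \<Rightarrow> complex"
  assumes zeros: "\<And>n. z n \<in> \<D>"
    and blaschke_condition: "summable (\<lambda>n. 1 - cmod (z n))"
begin

text \<open>The product over the zeros with index in \<open>A\<close>. The full product and the products with one factor
  omitted are the instances needed.\<close>

definition subproduct :: "nat set \<Rightarrow> complex \<Rightarrow> complex"
  where "subproduct A w = (\<Prod>n. if n \<in> A then blaschke_factor (z n) w else 1)"

lemma
  holomorphic_subproduct: "subproduct A holomorphic_on \<D>" and
  convergent_subproduct: "w \<in> \<D> \<Longrightarrow> convergent_prod (\<lambda>n. if n \<in> A then blaschke_factor (z n) w else 1)"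
proof -
  let ?F = "\<lambda>n w. if n \<in> A then blaschke_factor (z n) w else 1"
  have hol: "?F n holomorphic_on \<D>" for n
    using holomorphic_blaschke_factor[OF zeros] by (cases "n \<in> A") auto
  have bound: "\<exists>M. summable M \<and> (\<forall>n. \<forall>w\<in>K. cmod (?F n w - 1) \<le> M n)"
    if K: "compact K" "K \<subseteq> \<D>" for K
  proof -
    obtain \<rho> where \<rho>: "\<rho> < 1" "\<And>w. w \<in> K \<Longrightarrow> cmod w \<le> \<rho>"
    proof (cases "K = {}")
      case True
      then show ?thesis using that[of 0] by simp
    next
      case False
      then obtain x where "x \<in> K" "\<And>w. w \<in> K \<Longrightarrow> cmod w \<le> cmod x"
        using continuous_attains_sup[OF K(1) False, of cmod] continuous_on_norm_id by blast
      then show ?thesis using that[of "cmod x"] K(2) by auto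
    qed
    have "cmod (?F n w - 1) \<le> 2 / (1 - \<rho>) * (1 - cmod (z n))" if "w \<in> K" for n w
    proof (cases "n \<in> A")
      case True
      then show ?thesis using blaschke_factor_near_one[OF zeros \<rho>(2)[OF that] \<rho>(1)] by simp
    next
      case False
      have "0 \<le> 1 - cmod (z n)" using zeros[of n] by simp
      then show ?thesis using False \<rho>(1) by simp
    qed
    moreover have "summable (\<lambda>n. 2 / (1 - \<rho>) * (1 - cmod (z n)))"
      using blaschke_condition by (rule summable_mult)
    ultimately show ?thesis by blast
  qed
  show "subproduct A holomorphic_on \<D>"
    unfolding subproduct_def[abs_def] using open_ball hol bound by (rule holomorphic_prodinf(1))
  show "convergent_prod (\<lambda>n. ?F n w)" if "w \<in> \<D>"
    using open_ball hol bound that by (rule holomorphic_prodinf(2))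
qed

lemma subproduct_LIMSEQ:
  assumes "w \<in> \<D>"
  shows "(\<lambda>M. \<Prod>n\<in>A \<inter> {..<M}. cmod (disk_involution (z n) w)) \<longlonglongrightarrow> cmod (subproduct A w)"
proof -
  have "(\<lambda>M. \<Prod>n<M. if n \<in> A then blaschke_factor (z n) w else 1) \<longlonglongrightarrow> subproduct A w"
    using convergent_prod_LIMSEQ[OF convergent_subproduct[OF assms]]
    unfolding subproduct_def LIMSEQ_lessThan_iff_atMost by blast
  then have "(\<lambda>M. cmod (\<Prod>n<M. if n \<in> A then blaschke_factor (z n) w else 1)) \<longlonglongrightarrow> cmod (subproduct A w)"
    by (rule tendsto_norm)
  moreover have "cmod (\<Prod>n<M. if n \<in> A then blaschke_factor (z n) w else 1) =
      (\<Prod>n\<in>A \<inter> {..<M}. cmod (disk_involution (z n) w))" for M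
  proof -
    have "(\<Prod>n<M. if n \<in> A then blaschke_factor (z n) w else 1) = (\<Prod>n\<in>A \<inter> {..<M}. blaschke_factor (z n) w)"
      by (simp add: prod.If_cases Int_commute)
    then show ?thesis by (simp add: prod_norm[symmetric] norm_blaschke_factor)
  qed
  ultimately show ?thesis by simp
qed

lemma factor_bounds: "w \<in> \<D> \<Longrightarrow> 0 \<le> cmod (disk_involution (z n) w) \<and> cmod (disk_involution (z n) w) \<le> 1"
  using disk_involution_in_disk[OF zeros, of w n] by simp

text \<open>All factors have modulus at most 1, so omitting some of them can only increase the modulus.\<close>

lemma norm_subproduct_le:
  assumes w: "w \<in> \<D>" and J: "finite J" "J \<subseteq> A"
  shows "cmod (subproduct A w) \<le> (\<Prod>n\<in>J. cmod (disk_involution (z n) w))"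
proof (rule LIMSEQ_le_const2[OF subproduct_LIMSEQ[OF w]])
  obtain N where N: "J \<subseteq> {..<N}" using finite_nat_iff_bounded J(1) by blast
  have "(\<Prod>n\<in>A \<inter> {..<M}. cmod (disk_involution (z n) w)) \<le> (\<Prod>n\<in>J. cmod (disk_involution (z n) w))"
    if "M \<ge> N" for M
  proof -
    have "J \<subseteq> A \<inter> {..<M}" using N J(2) that by force
    then have eq: "(\<Prod>n\<in>A \<inter> {..<M}. cmod (disk_involution (z n) w)) =
        (\<Prod>n\<in>(A \<inter> {..<M}) - J. cmod (disk_involution (z n) w)) * (\<Prod>n\<in>J. cmod (disk_involution (z n) w))"
      by (intro prod.subset_diff) auto
    have "(\<Prod>n\<in>(A \<inter> {..<M}) - J. cmod (disk_involution (z n) w)) \<le> 1"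
      using factor_bounds[OF w] by (intro prod_le_1) auto
    then show ?thesis
      unfolding eq by (intro mult_left_le_one_le prod_nonneg) auto
  qed
  then show "\<exists>N. \<forall>M\<ge>N. (\<Prod>n\<in>A \<inter> {..<M}. cmod (disk_involution (z n) w)) \<le>
      (\<Prod>n\<in>J. cmod (disk_involution (z n) w))" by blast
qed

lemma norm_subproduct_le1: "w \<in> \<D> \<Longrightarrow> cmod (subproduct A w) \<le> 1"
  using norm_subproduct_le[of w "{}" A] by simp

lemma subproduct_split:
  assumes w: "w \<in> \<D>"
  shows "subproduct UNIV w = blaschke_factor (z k) w * subproduct (- {k}) w"
proof -
  have one: "(\<lambda>n. if n = k then blaschke_factor (z n) w else 1) has_prod blaschke_factor (z k) w"
    by (rule has_prod_single)
  have "prodinf (\<lambda>n. if n = k then blaschke_factor (z n) w else 1) * subproduct (- {k}) w =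
      (\<Prod>n. (if n = k then blaschke_factor (z n) w else 1) * (if n \<in> - {k} then blaschke_factor (z n) w else 1))"
    unfolding subproduct_def
    by (rule prodinf_mult[OF _ convergent_subproduct[OF w]]) (use one has_prod_iff in blast)
  also have "\<dots> = subproduct UNIV w"
    unfolding subproduct_def by (rule prodinf_cong) simp
  finally show ?thesis using one has_prod_iff by metis
qed

lemma norm_subproduct_at_zero:
  "cmod (subproduct (- {k}) (z k)) = (\<Prod>j. if j = k then 1 else pseudohyp_dist (z j) (z k))"
proof -
  have "(\<lambda>j. if j \<in> - {k} then blaschke_factor (z j) (z k) else 1) has_prod subproduct (- {k}) (z k)"
    unfolding subproduct_def using convergent_subproduct[OF zeros] by (rule convergent_prod_has_prod)
  then have "(\<lambda>j. cmod (if j \<in> - {k} then blaschke_factor (z j) (z k) else 1)) has_prod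
      cmod (subproduct (- {k}) (z k))" by (rule has_prod_norm)
  moreover have "cmod (if j \<in> - {k} then blaschke_factor (z j) (z k) else 1) =
      (if j = k then 1 else pseudohyp_dist (z j) (z k))" for j
    by (simp add: norm_blaschke_factor pseudohyp_dist_eq norm_disk_involution_commute[of "z j"])
  ultimately show ?thesis by (simp add: has_prod_iff)
qed

end

section \<open>Sublevel sets of thin Blaschke products\<close>

lemma thin_thresholds:
  fixes \<delta> :: "nat \<Rightarrow> real"
  assumes \<delta>: "\<delta> \<longlonglongrightarrow> 1" and R: "0 < R" "R < 1" and \<rho>: "\<rho> < R"
  shows "\<exists>N. \<forall>k\<ge>N. 4 * (1 - (\<delta> k)\<^sup>2) / (1 - R)\<^sup>2 < \<delta> k \<and>
    \<rho> < R * (\<delta> k - (1 - (\<delta> k)\<^sup>2) * R / (1 - R))"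
proof -
  have "(\<lambda>k. \<delta> k - 4 * (1 - (\<delta> k)\<^sup>2) / (1 - R)\<^sup>2) \<longlonglongrightarrow> 1 - 4 * (1 - 1\<^sup>2) / (1 - R)\<^sup>2"
    using R by (intro tendsto_intros \<delta>) auto
  then have "eventually (\<lambda>k. 0 < \<delta> k - 4 * (1 - (\<delta> k)\<^sup>2) / (1 - R)\<^sup>2) sequentially"
    by (rule order_tendstoD(1)) simp
  moreover have "(\<lambda>k. R * (\<delta> k - (1 - (\<delta> k)\<^sup>2) * R / (1 - R))) \<longlonglongrightarrow> R * (1 - (1 - 1\<^sup>2) * R / (1 - R))"
    using R by (intro tendsto_intros \<delta>) auto
  then have "eventually (\<lambda>k. \<rho> < R * (\<delta> k - (1 - (\<delta> k)\<^sup>2) * R / (1 - R))) sequentially"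
    by (rule order_tendstoD(1)) (use \<rho> in simp)
  ultimately have "eventually (\<lambda>k. 4 * (1 - (\<delta> k)\<^sup>2) / (1 - R)\<^sup>2 < \<delta> k \<and>
      \<rho> < R * (\<delta> k - (1 - (\<delta> k)\<^sup>2) * R / (1 - R))) sequentially"
    by eventually_elim simp
  then show ?thesis by (simp add: eventually_sequentially)
qed

lemma near_boundary:
  assumes cont: "continuous_on (cball 0 1) G" and one: "\<And>x. cmod x = 1 \<Longrightarrow> G x = (1::real)" and "t < 1"
  shows "\<exists>s<1. \<forall>x\<in>\<D>. G x \<le> t \<longrightarrow> cmod x \<le> s"
proof -
  \<comment> \<open>A compact set that does not meet the unit circle.\<close>
  define X where "X = cball 0 1 \<inter> G -` {..t}"
  have X: "compact X"
    unfolding X_def using continuous_closed_preimage[OF cont closed_cball closed_atMost]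
    by (simp add: compact_eq_bounded_closed bounded_Int)
  show ?thesis
  proof (cases "X = {}")
    case True
    then have "\<forall>x\<in>\<D>. G x \<le> t \<longrightarrow> cmod x \<le> 0" unfolding X_def by force
    then show ?thesis using zero_less_one by blast
  next
    case False
    obtain x where x: "x \<in> X" "\<And>y. y \<in> X \<Longrightarrow> cmod y \<le> cmod x"
      using continuous_attains_sup[OF X False, of cmod] continuous_on_norm_id by blast
    have "cmod x \<noteq> 1" using one[of x] x(1) \<open>t < 1\<close> unfolding X_def by auto
    then have "cmod x < 1" using x(1) unfolding X_def by auto
    moreover have "\<forall>y\<in>\<D>. G y \<le> t \<longrightarrow> cmod y \<le> cmod x"
      using x(2) unfolding X_def by auto
    ultimately show ?thesis by blast
  qed
qed

context blaschke_sequence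
begin

text \<open>In the coordinate centred at a zero, the corresponding factor is a rotation of \<open>\<zeta>\<close>.\<close>

lemma pulled_back_to_zero:
  assumes c: "cmod c = 1" and B: "\<And>w. w \<in> \<D> \<Longrightarrow> B w = c * subproduct UNIV w"
  shows "\<exists>h. h holomorphic_on \<D> \<and>
    (\<forall>\<zeta>\<in>\<D>. cmod (h \<zeta>) = cmod (subproduct (- {k}) (disk_involution (z k) \<zeta>)) \<and>
      B (disk_involution (z k) \<zeta>) = \<zeta> * h \<zeta>)"
proof -
  obtain u where u: "cmod u = 1"
      "\<forall>\<zeta>\<in>\<D>. blaschke_factor (z k) (disk_involution (z k) \<zeta>) = u * \<zeta>"
    using blaschke_factor_rotation[OF zeros] by blast
  define h where "h \<zeta> = c * u * subproduct (- {k}) (disk_involution (z k) \<zeta>)" for \<zeta>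
  note D = disk_involution_in_disk[OF zeros, of _ k]
  have "(\<lambda>\<zeta>. subproduct (- {k}) (disk_involution (z k) \<zeta>)) holomorphic_on \<D>"
    by (rule holomorphic_on_compose_gen[unfolded o_def, OF holomorphic_disk_involution[OF zeros]
          holomorphic_subproduct]) (use D in blast)
  then have "h holomorphic_on \<D>" unfolding h_def by (intro holomorphic_on_mult holomorphic_on_const)
  moreover have "cmod (h \<zeta>) = cmod (subproduct (- {k}) (disk_involution (z k) \<zeta>))" for \<zeta>
    unfolding h_def using c u(1) by (simp add: norm_mult)
  moreover have "B (disk_involution (z k) \<zeta>) = \<zeta> * h \<zeta>" if "\<zeta> \<in> \<D>" for \<zeta>
    unfolding B[OF D[OF that]] subproduct_split[OF D[OF that], of k] h_def using u(2) that by simp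
  ultimately show ?thesis by blast
qed

lemma cofactor_lower_bound:
  assumes x: "x \<in> \<D>" "cmod (disk_involution (z k) x) \<le> R" and R: "R < 1"
  defines "\<delta> \<equiv> cmod (subproduct (- {k}) (z k))"
  shows "\<delta> - (1 - \<delta>\<^sup>2) * R / (1 - R) \<le> cmod (subproduct (- {k}) x)"
proof -
  define g where "g \<zeta> = subproduct (- {k}) (disk_involution (z k) \<zeta>)" for \<zeta>
  define \<zeta> where "\<zeta> = disk_involution (z k) x"
  note D = disk_involution_in_disk[OF zeros, of _ k]
  have "g holomorphic_on \<D>"
    unfolding g_def
    by (rule holomorphic_on_compose_gen[unfolded o_def, OF holomorphic_disk_involution[OF zeros]
          holomorphic_subproduct]) (use D in blast)
  moreover have "cmod (g w) \<le> 1" if "w \<in> \<D>" for w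
    unfolding g_def using norm_subproduct_le1[OF D[OF that]] .
  ultimately have "cmod (g \<zeta> - g 0) \<le> (1 - (cmod (g 0))\<^sup>2) * R / (1 - R)"
    using x(2) R unfolding \<zeta>_def by (intro oscillation_bound) auto
  moreover have "g 0 = subproduct (- {k}) (z k)" unfolding g_def disk_involution_def by simp
  moreover have "g \<zeta> = subproduct (- {k}) x"
    unfolding g_def \<zeta>_def using disk_involution_involution[OF zeros x(1)] by simp
  moreover have "cmod (g 0) - cmod (g \<zeta>) \<le> cmod (g \<zeta> - g 0)"
    by (metis norm_minus_commute norm_triangle_ineq2)
  ultimately show ?thesis unfolding \<delta>_def by simp
qed

lemma sheet_near_zero:
  assumes c: "cmod c = 1" and B: "\<And>w. w \<in> \<D> \<Longrightarrow> B w = c * subproduct UNIV w"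
    and r: "0 < r" and R: "0 < R" "R < 1"
    and \<delta>: "\<delta> = cmod (subproduct (- {k}) (z k))"
    and inj: "4 * (1 - \<delta>\<^sup>2) / (1 - R)\<^sup>2 < \<delta>"
    and large: "r < R * (\<delta> - (1 - \<delta>\<^sup>2) * R / (1 - R))"
  shows "sheet_over_disk B r {w \<in> \<D>. cmod (disk_involution (z k) w) < R \<and> cmod (B w) < r}"
proof (rule sheet_in_pseudohyp_disk[OF _ zeros _ r R])
  note D = disk_involution_in_disk[OF zeros, of _ k]
  have "(\<lambda>w. c * subproduct UNIV w) holomorphic_on \<D>"
    by (intro holomorphic_on_mult holomorphic_on_const holomorphic_subproduct)
  then show "B holomorphic_on \<D>" by (rule holomorphic_transform) (use B in simp)
  obtain h where h: "h holomorphic_on \<D>"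
      "\<And>\<zeta>. \<zeta> \<in> \<D> \<Longrightarrow> cmod (h \<zeta>) = cmod (subproduct (- {k}) (disk_involution (z k) \<zeta>))"
      "\<And>\<zeta>. \<zeta> \<in> \<D> \<Longrightarrow> B (disk_involution (z k) \<zeta>) = \<zeta> * h \<zeta>"
    using pulled_back_to_zero[OF c B] by blast
  have Bx: "B x = disk_involution (z k) x * h (disk_involution (z k) x)" if "x \<in> \<D>" for x
    using h(3)[OF D[OF that]] disk_involution_involution[OF zeros that] by simp
  have "disk_involution (z k) (z k) = 0" by (simp add: disk_involution_def)
  then show "B (z k) = 0" using Bx[OF zeros] by simp
  have h0: "cmod (h 0) = \<delta>" using h(2)[of 0] unfolding \<delta> by (simp add: disk_involution_def)
  have "inj_on (\<lambda>\<zeta>. \<zeta> * h \<zeta>) (ball 0 R)"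
  proof (rule injective_of_large_derivative[OF h(1) _ R])
    show "cmod (h \<zeta>) \<le> 1" if "\<zeta> \<in> \<D>" for \<zeta>
      using h(2)[OF that] norm_subproduct_le1[OF D[OF that]] by simp
  qed (use inj h0 in simp)
  note inj' = inj_onD[OF this]
  show "inj_on B {w \<in> \<D>. cmod (disk_involution (z k) w) < R}"
  proof (rule inj_onI)
    fix x y assume x: "x \<in> {w \<in> \<D>. cmod (disk_involution (z k) w) < R}"
      and y: "y \<in> {w \<in> \<D>. cmod (disk_involution (z k) w) < R}" and eq: "B x = B y"
    then have "disk_involution (z k) x = disk_involution (z k) y"
      using Bx[of x] Bx[of y] inj'[of "disk_involution (z k) x" "disk_involution (z k) y"] by simp
    then have "disk_involution (z k) (disk_involution (z k) x) = disk_involution (z k) (disk_involution (z k) y)"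
      by simp
    then show "x = y"
      using disk_involution_involution[OF zeros, of x k] disk_involution_involution[OF zeros, of y k] x y
      by simp
  qed
  fix x assume x: "x \<in> \<D>" "cmod (disk_involution (z k) x) = R"
  have "\<delta> - (1 - \<delta>\<^sup>2) * R / (1 - R) \<le> cmod (subproduct (- {k}) x)"
    unfolding \<delta> using x R by (intro cofactor_lower_bound) auto
  also have "\<dots> = cmod (h (disk_involution (z k) x))"
    using h(2)[OF D[OF x(1)]] disk_involution_involution[OF zeros x(1)] by simp
  finally have "R * (\<delta> - (1 - \<delta>\<^sup>2) * R / (1 - R)) \<le> R * cmod (h (disk_involution (z k) x))"
    using R(1) by (intro mult_left_mono) auto
  also have "\<dots> = cmod (B x)" using Bx[OF x(1)] x(2) by (simp add: norm_mult)
  finally show "r < cmod (B x)" using large by simp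
qed

text \<open>The minimum principle bounds the finite products over \<open>N \<le> j < M\<close> below, uniformly in \<open>M\<close>. Working
  with finite products avoids the boundary behaviour of the infinite product.\<close>

lemma lower_bound_off_disks:
  assumes c: "cmod c = 1" and B: "\<And>w. w \<in> \<D> \<Longrightarrow> B w = c * subproduct UNIV w"
    and R: "0 < R" "R < 1" and \<rho>: "0 < \<rho>" "\<rho> \<le> 1"
    and large: "\<And>k x. N \<le> k \<Longrightarrow> x \<in> \<D> \<Longrightarrow> cmod (disk_involution (z k) x) = R \<Longrightarrow>
      \<rho> \<le> R * cmod (subproduct (- {k}) x)"
    and w: "w \<in> \<D>" "\<And>k. N \<le> k \<Longrightarrow> R \<le> cmod (disk_involution (z k) w)"
  shows "\<rho> * (\<Prod>j<N. cmod (disk_involution (z j) w)) \<le> cmod (B w)"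
proof -
  have tail: "\<rho> \<le> (\<Prod>j\<in>{N..<M}. cmod (disk_involution (z j) w))" for M
  proof (rule finite_product_minimum[OF _ zeros R(1) \<rho> _ w(1)])
    fix k x assume k: "k \<in> {N..<M}" and x: "x \<in> \<D>" "cmod (disk_involution (z k) x) = R"
    have "\<rho> \<le> R * cmod (subproduct (- {k}) x)" using large k x by simp
    also have "\<dots> \<le> R * (\<Prod>j\<in>{N..<M} - {k}. cmod (disk_involution (z j) x))"
      using R(1) by (intro mult_left_mono norm_subproduct_le[OF x(1)]) auto
    also have "\<dots> = (\<Prod>j\<in>{N..<M}. cmod (disk_involution (z j) x))"
      using prod.remove[OF _ k, of "\<lambda>j. cmod (disk_involution (z j) x)"] x(2) by simp
    finally show "\<rho> \<le> (\<Prod>j\<in>{N..<M}. cmod (disk_involution (z j) x))" .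
  qed (use w(2) in auto)
  have "cmod (B w) = cmod (subproduct UNIV w)" using B[OF w(1)] c by (simp add: norm_mult)
  moreover have "\<rho> * (\<Prod>j<N. cmod (disk_involution (z j) w)) \<le> cmod (subproduct UNIV w)"
  proof (rule LIMSEQ_le_const[OF subproduct_LIMSEQ[OF w(1)]], intro exI allI impI)
    fix M assume "N \<le> M"
    then have "{..<M} = {..<N} \<union> {N..<M}" by auto
    then have "(\<Prod>j\<in>UNIV \<inter> {..<M}. cmod (disk_involution (z j) w)) =
        (\<Prod>j<N. cmod (disk_involution (z j) w)) * (\<Prod>j\<in>{N..<M}. cmod (disk_involution (z j) w))"
      by (simp add: prod.union_disjoint ivl_disj_int)
    also have "\<dots> \<ge> (\<Prod>j<N. cmod (disk_involution (z j) w)) * \<rho>"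
      using tail by (intro mult_left_mono prod_nonneg) auto
    finally show "\<rho> * (\<Prod>j<N. cmod (disk_involution (z j) w)) \<le>
        (\<Prod>j\<in>UNIV \<inter> {..<M}. cmod (disk_involution (z j) w))" by (simp add: mult.commute)
  qed
  ultimately show ?thesis by simp
qed

text \<open>All zeros from some index on carry a sheet. Outside these sheets \<open>|B|\<close> is at least a constant
  larger than \<open>r\<close> times a finite Blaschke product, whose modulus tends to 1 at the unit circle.\<close>

theorem sublevel_sets_of_thin:
  assumes c: "cmod c = 1" and B: "\<And>w. w \<in> \<D> \<Longrightarrow> B w = c * subproduct UNIV w"
    and thin: "(\<lambda>k. cmod (subproduct (- {k}) (z k))) \<longlonglongrightarrow> 1" and r: "0 < r" "r < 1"
  shows "(\<exists>U. sheet_over_disk B r U) \<and>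
    (\<exists>s<1. \<forall>w\<in>\<D>. cmod (B w) < r \<longrightarrow> cmod w \<le> s \<or> (\<exists>U. sheet_over_disk B r U \<and> w \<in> U))"
proof -
  \<comment> \<open>Any radii with r < \<rho> < R < 1 would do.\<close>
  define R where "R = (1 + r) / 2"
  define \<rho> where "\<rho> = (r + R) / 2"
  have R: "0 < R" "R < 1" and \<rho>: "r < \<rho>" "\<rho> < R" "0 < \<rho>" "\<rho> \<le> 1"
    unfolding \<rho>_def R_def using r by (auto simp: field_simps)
  define \<delta> where "\<delta> k = cmod (subproduct (- {k}) (z k))" for k
  have "\<delta> \<longlonglongrightarrow> 1" using thin unfolding \<delta>_def .
  then obtain N where N: "\<And>k. N \<le> k \<Longrightarrow> 4 * (1 - (\<delta> k)\<^sup>2) / (1 - R)\<^sup>2 < \<delta> k"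
      "\<And>k. N \<le> k \<Longrightarrow> \<rho> < R * (\<delta> k - (1 - (\<delta> k)\<^sup>2) * R / (1 - R))"
    using thin_thresholds[OF _ R \<rho>(2)] by blast
  define U where "U k = {w \<in> \<D>. cmod (disk_involution (z k) w) < R \<and> cmod (B w) < r}" for k
  have sheet: "sheet_over_disk B r (U k)" if "N \<le> k" for k
    unfolding U_def
    by (rule sheet_near_zero[OF c B r(1) R \<delta>_def N(1)[OF that]]) (use N(2)[OF that] \<rho>(1) in linarith)+
  have large: "\<rho> \<le> R * cmod (subproduct (- {k}) x)"
    if "N \<le> k" "x \<in> \<D>" "cmod (disk_involution (z k) x) = R" for k x
  proof -
    have "\<delta> k - (1 - (\<delta> k)\<^sup>2) * R / (1 - R) \<le> cmod (subproduct (- {k}) x)"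
      unfolding \<delta>_def using that R by (intro cofactor_lower_bound) auto
    then have "R * (\<delta> k - (1 - (\<delta> k)\<^sup>2) * R / (1 - R)) \<le> R * cmod (subproduct (- {k}) x)"
      using R(1) by (intro mult_left_mono) auto
    then show ?thesis using N(2)[OF that(1)] by linarith
  qed
  define G where "G w = (\<Prod>j<N. cmod (disk_involution (z j) w))" for w
  have "continuous_on (cball 0 1) G"
    unfolding G_def by (intro continuous_on_prod continuous_on_norm continuous_disk_involution zeros)
  moreover have "G w = 1" if "cmod w = 1" for w
    unfolding G_def using norm_disk_involution_boundary[OF zeros that] by simp
  moreover have "r / \<rho> < 1" using \<rho> by simp
  ultimately obtain s where s: "s < 1" "\<And>w. w \<in> \<D> \<Longrightarrow> G w \<le> r / \<rho> \<Longrightarrow> cmod w \<le> s"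
    using near_boundary[of G "r / \<rho>"] by blast
  have "cmod w \<le> s \<or> (\<exists>U. sheet_over_disk B r U \<and> w \<in> U)" if w: "w \<in> \<D>" "cmod (B w) < r" for w
  proof (cases "\<exists>k\<ge>N. cmod (disk_involution (z k) w) < R")
    case True
    then obtain k where "N \<le> k" "w \<in> U k" using w unfolding U_def by blast
    then show ?thesis using sheet by blast
  next
    case False
    then have "\<rho> * G w \<le> cmod (B w)"
      unfolding G_def using w(1) by (intro lower_bound_off_disks[OF c B R \<rho>(3,4) large]) auto
    then have "G w \<le> r / \<rho>" using w(2) \<rho>(3) by (simp add: le_divide_eq mult.commute)
    then show ?thesis using s(2) w(1) by blast
  qed
  then show ?thesis using sheet s(1) by blast
qed

end

section \<open>From sublevel sets to charts\<close>

text \<open>Points of the fibre and zeros of the derivative are isolated. On a small circle around \<open>c\<close> the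
  function stays away from \<open>f c\<close>, which makes the preimage of a smaller disk relatively closed.\<close>

lemma chart_at_point:
  assumes hol: "f holomorphic_on \<D>" and nonconst: "\<not> f constant_on \<D>"
    and d0: "\<exists>b\<in>\<D>. deriv f b \<noteq> 0" and c: "c \<in> \<D>"
  shows "\<exists>\<delta>>0. \<exists>d>0. \<forall>e. 0 < e \<and> e \<le> d \<longrightarrow>
    branched_chart f (f c) e {x \<in> ball c \<delta>. f x \<in> ball (f c) e} c"
proof -
  obtain b where b: "b \<in> \<D>" "f b \<noteq> f c"
    using nonconst unfolding constant_on_def by blast
  obtain r1 where r1: "0 < r1" "ball c r1 \<subseteq> \<D>" "\<And>x. x \<in> ball c r1 - {c} \<Longrightarrow> f x - f c \<noteq> 0"
  proof (rule isolated_zeros[of "\<lambda>x. f x - f c" \<D> c b])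
    show "(\<lambda>x. f x - f c) holomorphic_on \<D>" by (intro holomorphic_on_diff hol holomorphic_on_const)
  qed (use c b in auto)
  obtain r2 where r2: "0 < r2" "\<And>x. x \<in> ball c r2 - {c} \<Longrightarrow> deriv f x \<noteq> 0"
      "deriv f c \<noteq> 0 \<Longrightarrow> inj_on f (ball c r2)"
  proof (cases "deriv f c = 0")
    case True
    obtain b where b: "b \<in> \<D>" "deriv f b \<noteq> 0" using d0 by blast
    obtain r where "0 < r" "\<And>x. x \<in> ball c r - {c} \<Longrightarrow> deriv f x \<noteq> 0"
    proof (rule isolated_zeros[of "deriv f" \<D> c b])
      show "deriv f holomorphic_on \<D>" by (intro holomorphic_deriv hol open_ball)
    qed (use c b True in auto)
    then show ?thesis using that True by blast
  next
    case False
    then obtain r where r: "r > 0" "ball c r \<subseteq> \<D>" "inj_on f (ball c r)"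
      using has_complex_derivative_locally_injective[OF hol c open_ball] by blast
    have "deriv f x \<noteq> 0" if "x \<in> ball c r" for x
      using holomorphic_injective_imp_regular[OF holomorphic_on_subset[OF hol r(2)] open_ball r(3) that] .
    then show ?thesis using that r by blast
  qed
  define \<delta> where "\<delta> = min r1 r2 / 2"
  have \<delta>: "0 < \<delta>" "cball c \<delta> \<subseteq> ball c r1" "cball c \<delta> \<subseteq> ball c r2"
    unfolding \<delta>_def using r1(1) r2(1) by (auto simp: subset_eq)
  have \<delta>D: "cball c \<delta> \<subseteq> \<D>" using \<delta>(2) r1(2) by blast
  note cont = continuous_on_subset[OF holomorphic_on_imp_continuous_on[OF hol] \<delta>D]
  have "compact (f ` sphere c \<delta>)"
    by (intro compact_continuous_image continuous_on_subset[OF cont]) auto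
  then have "open (- f ` sphere c \<delta>)" by (simp add: compact_imp_closed open_Compl)
  moreover have "f c \<notin> f ` sphere c \<delta>"
  proof
    assume "f c \<in> f ` sphere c \<delta>"
    then obtain x where x: "x \<in> sphere c \<delta>" "f x = f c" by auto
    then have "x \<in> ball c r1 - {c}" using \<delta> by auto
    then show False using r1(3) x(2) by auto
  qed
  ultimately obtain d1 where d1: "d1 > 0" "ball (f c) d1 \<subseteq> - f ` sphere c \<delta>"
    by (meson ComplI openE)
  obtain d2 where d2: "d2 > 0" "deriv f c \<noteq> 0 \<Longrightarrow> ball (f c) d2 \<subseteq> f ` ball c \<delta>"
  proof (cases "deriv f c = 0")
    case True
    then show ?thesis using that[of 1] by simp
  next
    case False
    have sub: "ball c \<delta> \<subseteq> ball c r2" using \<delta>(3) ball_subset_cball by blast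
    have "open (f ` ball c \<delta>)"
    proof (rule open_mapping_thm[OF hol open_ball connected_ball open_ball _ nonconst])
      show "ball c \<delta> \<subseteq> \<D>" using \<delta>D ball_subset_cball by blast
    qed
    moreover have "f c \<in> f ` ball c \<delta>" using \<delta>(1) by simp
    ultimately obtain d where "d > 0" "ball (f c) d \<subseteq> f ` ball c \<delta>" by (metis openE)
    then show ?thesis using that by blast
  qed
  have "branched_chart f (f c) e {x \<in> ball c \<delta>. f x \<in> ball (f c) e} c" (is "branched_chart f _ e ?N c")
    if e: "0 < e" "e \<le> min d1 d2" for e
  proof -
    have N: "?N = ball c \<delta> \<inter> f -` ball (f c) e" by auto
    have sub: "ball c \<delta> \<subseteq> \<D>" using \<delta>D ball_subset_cball by blast
    have "open ?N"
      unfolding N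
      by (intro continuous_open_preimage open_ball continuous_on_subset[OF cont] ball_subset_cball)
    moreover have cl: "closure ?N \<subseteq> cball c \<delta>"
      by (rule closure_minimal) auto
    moreover have "x \<in> ?N" if x: "x \<in> closure ?N" "f x \<in> ball (f c) e" for x
    proof -
      have "ball (f c) e \<subseteq> ball (f c) d1" using e(2) by (intro subset_ball) simp
      then have "f x \<notin> f ` sphere c \<delta>" using d1(2) x(2) by blast
      then have "x \<notin> sphere c \<delta>" by blast
      then have "x \<in> ball c \<delta>" using cl x(1) by auto
      then show ?thesis using x(2) by blast
    qed
    moreover have "x = c" if x: "x \<in> ?N" "f x = f c \<or> deriv f x = 0" for x
    proof (rule ccontr)
      assume "x \<noteq> c"
      moreover have "x \<in> cball c \<delta>" using x(1) by auto
      ultimately have "x \<in> ball c r1 - {c}" "x \<in> ball c r2 - {c}" using \<delta>(2,3) by blast+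
      then show False using r1(3) r2(2) x(2) by auto
    qed
    moreover have "inj_on f ?N" if "deriv f c \<noteq> 0"
      using r2(3)[OF that] by (rule inj_on_subset) (use \<delta>(3) ball_subset_cball in blast)
    moreover have "f ` ?N = ball (f c) e" if "deriv f c \<noteq> 0"
    proof -
      have "ball (f c) e \<subseteq> ball (f c) d2" using e(2) by (intro subset_ball) simp
      then show ?thesis using d2(2)[OF that] by blast
    qed
    moreover have "c \<in> ?N" using \<delta>(1) e(1) by simp
    moreover have "closure ?N \<subseteq> \<D>" using cl \<delta>D by blast
    moreover have "f ` ?N \<subseteq> ball (f c) e" by blast
    ultimately show ?thesis unfolding branched_chart_def by blast
  qed
  then show ?thesis
    using \<delta>(1) d1(1) d2(1) by (intro exI[of _ \<delta>] exI[of _ "min d1 d2"] conjI allI impI) auto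
qed

lemma chart_in_sheet:
  assumes hol: "f holomorphic_on \<D>" and U: "sheet_over_disk f r U" and e: "0 < e" "ball q e \<subseteq> ball 0 r"
    and z: "z \<in> U" "f z \<in> ball q e"
  shows "\<exists>N c. branched_chart f q e N c \<and> z \<in> N"
proof -
  have opU: "open U" and clU: "closure U \<subseteq> \<D>" and inj: "inj_on f U" and onto: "f ` U = ball 0 r"
    and closed: "\<And>x. x \<in> closure U \<Longrightarrow> f x \<in> ball 0 r \<Longrightarrow> x \<in> U"
    using U unfolding sheet_over_disk_def by blast+
  have UD: "U \<subseteq> \<D>" using clU closure_subset by blast
  have holU: "f holomorphic_on U" using hol UD by (rule holomorphic_on_subset)
  have "q \<in> f ` U" unfolding onto using e(2) by (rule subsetD) (simp add: e(1))
  then obtain c where c: "c \<in> U" "f c = q" by blast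
  define N where "N = U \<inter> f -` ball q e"
  have "branched_chart f q e N c"
    unfolding branched_chart_def
  proof (intro conjI ballI impI)
    show "open N"
      unfolding N_def using holU opU
      by (intro continuous_open_preimage holomorphic_on_imp_continuous_on open_ball)
    show "c \<in> N" unfolding N_def using c e(1) by simp
    have clN: "closure N \<subseteq> closure U" unfolding N_def by (intro closure_mono) auto
    then show "closure N \<subseteq> \<D>" using clU by blast
    show "f ` N \<subseteq> ball q e" unfolding N_def by blast
    show "x \<in> N" if "x \<in> closure N" "f x \<in> ball q e" for x
      using closed[of x] clN that e(2) unfolding N_def by blast
    have reg: "deriv f x \<noteq> 0" if "x \<in> U" for x
      using holomorphic_injective_imp_regular[OF holU opU inj that] .
    show "x = c" if "x \<in> N" "f x = q \<or> deriv f x = 0" for x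
      using that reg inj c unfolding N_def by (auto dest: inj_onD)
    have NU: "N \<subseteq> U" unfolding N_def by blast
    show "inj_on f N" using inj NU by (rule inj_on_subset)
    show "f ` N = ball q e"
    proof
      show "f ` N \<subseteq> ball q e" unfolding N_def by blast
      show "ball q e \<subseteq> f ` N"
      proof
        fix y assume y: "y \<in> ball q e"
        then have "y \<in> f ` U" using e(2) unfolding onto by (rule subsetD[rotated])
        then obtain x where "x \<in> U" "y = f x" by (rule imageE)
        then show "y \<in> f ` N" using y unfolding N_def by blast
      qed
    qed
  qed (rule c)
  then show ?thesis using z unfolding N_def by blast
qed

text \<open>Given \<open>q\<close>, take \<open>r\<close> between \<open>|q|\<close> and 1. Sheets over the disk of radius \<open>r\<close> provide charts for every
  small disk around \<open>q\<close> at once. The remaining part of the sublevel set is compact and contains finitely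
  many points over \<open>q\<close>, so finitely many radii have to be respected there.\<close>

theorem branched_covering_of_sheets:
  assumes hol: "f holomorphic_on \<D>" and maps: "f ` \<D> \<subseteq> \<D>"
    and sheet: "\<And>r. 0 < r \<Longrightarrow> r < 1 \<Longrightarrow> \<exists>U. sheet_over_disk f r U"
    and rest: "\<And>r. 0 < r \<Longrightarrow> r < 1 \<Longrightarrow>
      \<exists>s<1. \<forall>z\<in>\<D>. cmod (f z) < r \<longrightarrow> cmod z \<le> s \<or> (\<exists>U. sheet_over_disk f r U \<and> z \<in> U)"
  shows "branched_disk_covering f"
proof
  show "f holomorphic_on \<D>" by (rule hol)
  have onto: "q \<in> f ` \<D>" if q: "q \<in> \<D>" for q
  proof -
    define r where "r = (1 + cmod q) / 2"
    have r: "0 < r" "r < 1" "cmod q < r"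
      unfolding r_def using q norm_ge_zero[of q] by (auto simp del: norm_ge_zero)
    obtain U where U: "sheet_over_disk f r U" using sheet r by blast
    then have "q \<in> f ` U" using r(3) unfolding sheet_over_disk_def by auto
    moreover have "U \<subseteq> \<D>" using U closure_subset unfolding sheet_over_disk_def by blast
    ultimately show ?thesis by blast
  qed
  then show surj: "f ` \<D> = \<D>" using maps by blast
  have nonconst: "\<not> f constant_on \<D>"
  proof
    assume "f constant_on \<D>"
    then obtain k where "\<And>z. z \<in> \<D> \<Longrightarrow> f z = k" unfolding constant_on_def by blast
    then have "(0::complex) = k" "1/2 = k" using onto[of 0] onto[of "1/2"] by auto
    then show False by simp
  qed
  have d0: "\<exists>b\<in>\<D>. deriv f b \<noteq> 0"
  proof -
    obtain U where "sheet_over_disk f (1/2) U" using sheet[of "1/2"] by auto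
    then have U: "open U" "closure U \<subseteq> \<D>" "inj_on f U" "f ` U = ball 0 (1/2)"
      unfolding sheet_over_disk_def by blast+
    have UD: "U \<subseteq> \<D>" using U(2) closure_subset by blast
    have "(0::complex) \<in> f ` U" unfolding U(4) by simp
    then obtain b where "b \<in> U" by blast
    then show ?thesis
      using holomorphic_injective_imp_regular[OF holomorphic_on_subset[OF hol UD] U(1,3)] UD by blast
  qed
  fix q assume q: "q \<in> \<D>"
  define r where "r = (1 + cmod q) / 2"
  have r: "0 < r" "r < 1" "cmod q < r"
    unfolding r_def using q norm_ge_zero[of q] by (auto simp del: norm_ge_zero)
  obtain s where s: "s < 1"
      "\<And>z. z \<in> \<D> \<Longrightarrow> cmod (f z) < r \<Longrightarrow> cmod z \<le> s \<or> (\<exists>U. sheet_over_disk f r U \<and> z \<in> U)"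
    using rest[OF r(1,2)] by blast
  have sD: "cball 0 s \<subseteq> \<D>" using s(1) by auto
  define X where "X = {c \<in> cball 0 s. f c = q}"
  have "finite {c \<in> cball 0 s. f c - q = 0}"
  proof (rule holomorphic_compact_finite_zeros[of "\<lambda>c. f c - q" \<D>])
    show "(\<lambda>c. f c - q) holomorphic_on \<D>" by (intro holomorphic_on_diff hol holomorphic_on_const)
    show "\<not> (\<lambda>c. f c - q) constant_on \<D>"
    proof
      assume "(\<lambda>c. f c - q) constant_on \<D>"
      then obtain k where "\<forall>z\<in>\<D>. f z - q = k" by (auto simp: constant_on_def)
      then have "\<forall>z\<in>\<D>. f z = k + q" by (simp add: diff_eq_eq)
      then show False using nonconst unfolding constant_on_def by blast
    qed
  qed (use sD in auto)
  then have finX: "finite X" unfolding X_def by simp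
  have "\<forall>c\<in>X. \<exists>\<delta> d. 0 < \<delta> \<and> 0 < d \<and> (\<forall>e. 0 < e \<and> e \<le> d \<longrightarrow>
      branched_chart f q e {x \<in> ball c \<delta>. f x \<in> ball q e} c)"
  proof
    fix c assume c: "c \<in> X"
    then have "c \<in> \<D>" "f c = q" using sD unfolding X_def by blast+
    then show "\<exists>\<delta> d. 0 < \<delta> \<and> 0 < d \<and> (\<forall>e. 0 < e \<and> e \<le> d \<longrightarrow>
        branched_chart f q e {x \<in> ball c \<delta>. f x \<in> ball q e} c)"
      using chart_at_point[OF hol nonconst d0, of c] by blast
  qed
  then obtain \<delta> d where \<delta>d: "\<And>c. c \<in> X \<Longrightarrow> 0 < \<delta> c" "\<And>c. c \<in> X \<Longrightarrow> 0 < d c"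
      "\<And>c e. c \<in> X \<Longrightarrow> 0 < e \<Longrightarrow> e \<le> d c \<Longrightarrow>
        branched_chart f q e {x \<in> ball c (\<delta> c). f x \<in> ball q e} c"
    by metis
  \<comment> \<open>On this compact set f omits q, hence a whole disk around q.\<close>
  define Y where "Y = cball 0 s - (\<Union>c\<in>X. ball c (\<delta> c))"
  have "compact Y" unfolding Y_def by (intro compact_diff) auto
  moreover have "Y \<subseteq> \<D>" using sD unfolding Y_def by blast
  ultimately have "compact (f ` Y)"
    by (intro compact_continuous_image continuous_on_subset[OF holomorphic_on_imp_continuous_on[OF hol]])
  then have "open (- f ` Y)" by (simp add: compact_imp_closed open_Compl)
  moreover have "q \<notin> f ` Y"
  proof
    assume "q \<in> f ` Y"
    then obtain x where x: "x \<in> Y" "f x = q" by blast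
    then have "x \<in> X" unfolding X_def Y_def by blast
    then have "x \<in> ball x (\<delta> x)" using \<delta>d(1) by simp
    then show False using x(1) \<open>x \<in> X\<close> unfolding Y_def by blast
  qed
  ultimately obtain d1 where d1: "d1 > 0" "ball q d1 \<subseteq> - f ` Y" by (meson ComplI openE)
  define S where "S = insert d1 (insert (r - cmod q) (d ` X))"
  define D where "D = Min S"
  have S: "finite S" "S \<noteq> {}" unfolding S_def using finX by auto
  have D: "0 < D" "D \<le> d1" "D \<le> r - cmod q" "\<And>c. c \<in> X \<Longrightarrow> D \<le> d c"
  proof -
    have "\<forall>x\<in>S. 0 < x" unfolding S_def using d1(1) r(3) \<delta>d(2) by auto
    then show "0 < D" unfolding D_def using S by simp
    show "D \<le> d1" "D \<le> r - cmod q" "\<And>c. c \<in> X \<Longrightarrow> D \<le> d c"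
      unfolding D_def by (intro Min_le S(1), simp add: S_def)+
  qed
  have "\<exists>N c. branched_chart f q e N c \<and> z \<in> N"
    if e: "0 < e" "e \<le> D" and z: "z \<in> \<D>" "f z \<in> ball q e" for e z
  proof -
    have sub: "ball q e \<subseteq> ball 0 r"
    proof
      fix x assume "x \<in> ball q e"
      then have "cmod (x - q) < r - cmod q" using e(2) D(3) by (simp add: dist_norm norm_minus_commute)
      then show "x \<in> ball 0 r" using norm_triangle_ineq2[of x q] by simp
    qed
    then have "cmod (f z) < r" using z(2) by auto
    then consider "cmod z \<le> s" | U where "sheet_over_disk f r U" "z \<in> U" using s(2) z(1) by blast
    then show ?thesis
    proof cases
      case 1
      have "ball q e \<subseteq> ball q d1" using e(2) D(2) by (intro subset_ball) simp
      then have "f z \<notin> f ` Y" using z(2) d1(2) by blast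
      then have "z \<notin> Y" by blast
      then obtain c where c: "c \<in> X" "z \<in> ball c (\<delta> c)" using 1 unfolding Y_def by auto
      have "branched_chart f q e {x \<in> ball c (\<delta> c). f x \<in> ball q e} c"
        using \<delta>d(3)[OF c(1) e(1)] D(4)[OF c(1)] e(2) by simp
      then show ?thesis using c(2) z(2) by blast
    next
      case 2
      then show ?thesis using chart_in_sheet[OF hol _ e(1) sub _ z(2)] by blast
    qed
  qed
  then show "\<exists>d>0. \<forall>e. 0 < e \<and> e \<le> d \<longrightarrow>
      (\<forall>z\<in>\<D>. f z \<in> ball q e \<longrightarrow> (\<exists>N c. branched_chart f q e N c \<and> z \<in> N))"
    using D(1) by blast
qed

theorem corollary4p6:
  fixes B :: "complex \<Rightarrow> complex"
  assumes "thin_blaschke_product B"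
  shows "gluable B"
proof -
  obtain z c where z: "\<And>n. z n \<in> \<D>" "summable (\<lambda>n. 1 - cmod (z n))" and c: "cmod c = 1"
    and B0: "\<And>w. w \<in> \<D> \<Longrightarrow> B w = c * (\<Prod>n. blaschke_factor (z n) w)"
    and thin: "(\<lambda>k. \<Prod>j. if j = k then 1 else pseudohyp_dist (z j) (z k)) \<longlonglongrightarrow> 1"
    using assms unfolding thin_blaschke_product_def blaschke_product_with_zeros_def by blast
  interpret blaschke_sequence z by unfold_locales (fact z)+
  have B: "B w = c * subproduct UNIV w" if "w \<in> \<D>" for w
    using B0[OF that] unfolding subproduct_def by simp
  have "(\<lambda>w. c * subproduct UNIV w) holomorphic_on \<D>"
    by (intro holomorphic_on_mult holomorphic_on_const holomorphic_subproduct)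
  then have hol: "B holomorphic_on \<D>" by (rule holomorphic_transform) (use B in simp)
  have maps: "B ` \<D> \<subseteq> \<D>"
  proof (rule image_subsetI)
    fix w assume w: "w \<in> \<D>"
    have "cmod (subproduct UNIV w) \<le> (\<Prod>n\<in>{0}. cmod (disk_involution (z n) w))"
      using w by (intro norm_subproduct_le) auto
    also have "\<dots> < 1" using disk_involution_in_disk[OF zeros w] by simp
    finally show "B w \<in> \<D>" using B[OF w] c by (simp add: norm_mult)
  qed
  have lim: "(\<lambda>k. cmod (subproduct (- {k}) (z k))) \<longlonglongrightarrow> 1"
    using thin unfolding norm_subproduct_at_zero .
  note sublevel = sublevel_sets_of_thin[OF c B lim]
  have "branched_disk_covering B"
    by (rule branched_covering_of_sheets[OF hol maps]) (use sublevel in blast)+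
  then show ?thesis by (rule branched_disk_covering.gluable)
qed

end
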